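(* Let $d\mu=\mu(x)\,dx$ be a doubling measure on $\mathbf{R}^n$ and let $W:\mathbf{R}^n\to\mathcal{L}(\mathbf{R}^N)$ be a matrix weight for which there is $C_2<\infty$ with $$\det\big((W^2)_Q\big)\le C_2^2\exp\Big(\frac1{\mu(Q)}\int_Q\ln(\det W(x)^2)\,d\mu(x)\Big)$$ for all cubes $Q\subset\mathbf{R}^n$. Fix $\epsilon_3>0$. Consider the stopping criterion which selects the maximal subcubes $R\in\mathcal{D}$ of $Q\in\mathcal{D}$ for which $$|W_Q^{-1}W_R-I|>\epsilon_3.$$ Then the generations of stopping cubes, denoted $B_*^W(Q)$, satisfy the packing condition $$\sum_{R\in B_*^W(Q)}\mu(R)\lesssim\epsilon_3^{-2}\mu(Q).$$
   Context: A measure $\mu$ on $\mathbf{R}^n$ is doubling if $\mu(2Q)\le C_1\mu(Q)$ for all cubes $Q$, where $2Q$ is the concentric cube of twice the sidelength and $C_1<\infty$. A matrix weight is a measurable function $W:\mathbf{R}^n\to\mathcal{L}(\mathbf{R}^N)$ with $W(x)$ a positive definite (symmetric) matrix for almost every $x$; averages of $W$ and $W^2$ over cubes are understood to be finite. $W_Q:=\mu(Q)^{-1}\int_QW\,d\mu$ and $(W^2)_Q:=\mu(Q)^{-1}\int_QW^2\,d\mu$. $|\cdot|$ is the operator norm on matrices and $I$ is the identity matrix. $\mathcal{D}$ is the set of standard dyadic cubes in $\mathbf{R}^n$ (sidelengths $2^k$, $k\in\mathbf{Z}$). Given a stopping criterion, which selects for each $Q\in\mathcal{D}$ a set $B_1(Q)$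 of disjoint dyadic subcubes of $Q$, the generations of stopping cubes under $Q$ are defined by $B_0(Q):=\{Q\}$, $B_k(Q):=\bigcup_{R\in B_{k-1}(Q)}B_1(R)$ for $k\ge1$, and $B_*(Q):=\bigcup_{k=0}^\infty B_k(Q)$; $B_*^W(Q)$ is this collection for the stopping criterion in the claim. The notation $X\lesssim Y$ means $X\le CY$ for a finite constant $C$ independent of the cube $Q\in\mathcal{D}$. *)

theory Defs
  imports "HOL-Analysis.Analysis"
begin

text \<open>
  Axis-parallel cube with centre \<open>c\<close> and sidelength \<open>l\<close>, so that the concentric double of
  \<open>cube c l\<close> is \<open>cube c (2 * l)\<close>.  Cubes are half-open like the dyadic ones; only measures
  with a density are considered, so that faces are null sets.
\<close>

definition cube :: "real ^ 'n \<Rightarrow> real \<Rightarrow> (real ^ 'n) set" where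
  "cube c l = {x. \<forall>i. c $ i - l / 2 \<le> x $ i \<and> x $ i < c $ i + l / 2}"

definition dyadic_cubes :: "(real ^ 'n) set set" where
  "dyadic_cubes =
     {Q. \<exists>(k::int) (m::int ^ 'n).
           Q = {x. \<forall>i. of_int (m $ i) * 2 powi k \<le> x $ i \<and> x $ i < (of_int (m $ i) + 1) * 2 powi k}}"

text \<open>As usual, local finiteness is part of the notion of a doubling measure.\<close>

definition doubling :: "(real ^ 'n) measure \<Rightarrow> bool" where
  "doubling \<mu> \<longleftrightarrow>
     (\<forall>c l. 0 < l \<longrightarrow> emeasure \<mu> (cube c l) < \<infinity>) \<and>
     (\<exists>C1. \<forall>c l. 0 < l \<longrightarrow> measure \<mu> (cube c (2 * l)) \<le> C1 * measure \<mu> (cube c l))"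

definition pos_def :: "real ^ 'N ^ 'N \<Rightarrow> bool" where
  "pos_def A \<longleftrightarrow> transpose A = A \<and> (\<forall>v. v \<noteq> 0 \<longrightarrow> 0 < v \<bullet> (A *v v))"

text \<open>
  Positive definiteness is only required \<open>\<mu>\<close>-almost everywhere; for \<open>\<mu>\<close> with a density this is
  implied by positive definiteness Lebesgue-almost everywhere.
\<close>

definition matrix_weight :: "(real ^ 'n) measure \<Rightarrow> (real ^ 'n \<Rightarrow> real ^ 'N ^ 'N) \<Rightarrow> bool" where
  "matrix_weight \<mu> W \<longleftrightarrow>
     W \<in> borel_measurable \<mu> \<and>
     (AE x in \<mu>. pos_def (W x)) \<and>
     (\<forall>c l. 0 < l \<longrightarrow> set_integrable \<mu> (cube c l) W \<and> set_integrable \<mu> (cube c l) (\<lambda>x. W x ** W x))"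

definition average ::
    "'a measure \<Rightarrow> 'a set \<Rightarrow> ('a \<Rightarrow> 'b) \<Rightarrow> 'b::{banach, second_countable_topology}" where
  "average \<mu> Q f = (1 / measure \<mu> Q) *\<^sub>R (LINT x:Q|\<mu>. f x)"

text \<open>
  The determinant inequality
  \<open>det((W\<^sup>2)\<^sub>Q) \<le> C2\<^sup>2 exp (average over Q of ln(det W\<^sup>2))\<close> for all cubes \<open>Q\<close>.
  Since \<open>ln(det W\<^sup>2)\<close> is bounded above by the trace of \<open>W\<^sup>2\<close>, its average always exists in
  \<open>[-\<infinity>, \<infinity>)\<close>; the value \<open>-\<infinity>\<close> would make the right-hand side 0 and the inequality false.
  The Bochner integral of a non-integrable function is 0, so this implicit integrability has to be
  spelled out.
\<close>

definition det_reverse_Jensen ::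
    "(real ^ 'n) measure \<Rightarrow> (real ^ 'n \<Rightarrow> real ^ 'N ^ 'N) \<Rightarrow> real \<Rightarrow> bool" where
  "det_reverse_Jensen \<mu> W C2 \<longleftrightarrow>
     (\<forall>c l. 0 < l \<longrightarrow>
        set_integrable \<mu> (cube c l) (\<lambda>x. ln (det (W x ** W x))) \<and>
        det (average \<mu> (cube c l) (\<lambda>x. W x ** W x))
          \<le> C2\<^sup>2 * exp (average \<mu> (cube c l) (\<lambda>x. ln (det (W x ** W x)))))"

definition maximal_subcubes ::
    "((real ^ 'n) set \<Rightarrow> bool) \<Rightarrow> (real ^ 'n) set \<Rightarrow> (real ^ 'n) set set" where
  "maximal_subcubes P Q =
     {R \<in> dyadic_cubes. R \<subseteq> Q \<and> P R \<and> \<not> (\<exists>R'\<in>dyadic_cubes. R \<subset> R' \<and> R' \<subseteq> Q \<and> P R')}"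

primrec generation :: "('a set \<Rightarrow> 'a set set) \<Rightarrow> nat \<Rightarrow> 'a set \<Rightarrow> 'a set set" where
  "generation B1 0 Q = {Q}"
| "generation B1 (Suc k) Q = (\<Union>R\<in>generation B1 k Q. B1 R)"

definition all_generations :: "('a set \<Rightarrow> 'a set set) \<Rightarrow> 'a set \<Rightarrow> 'a set set" where
  "all_generations B1 Q = (\<Union>k. generation B1 k Q)"

definition weight_stopping ::
    "(real ^ 'n) measure \<Rightarrow> (real ^ 'n \<Rightarrow> real ^ 'N ^ 'N) \<Rightarrow> real
       \<Rightarrow> (real ^ 'n) set \<Rightarrow> (real ^ 'n) set set" where
  "weight_stopping \<mu> W \<epsilon> Q =
     maximal_subcubes
       (\<lambda>R. onorm ((*v) (matrix_inv (average \<mu> Q W) ** average \<mu> R W - mat 1)) > \<epsilon>) Q"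

end

theory Submission
  imports Defs
begin

text \<open>
  Write \<open>X = W\<^sub>Q\<close>, \<open>Y = (W\<^sup>2)\<^sub>Q\<close> and \<open>Z = Y - X\<^sup>2 / 2\<close>; since \<open>X\<^sup>2 \<le> Y\<close>, \<open>Z\<close> is positive definite.
  The potential is \<open>\<Phi>(Q) = \<mu>(Q) ln det Z - \<integral>\<^sub>Q ln det (W\<^sup>2 / 2) d\<mu>\<close>.  Bounding \<open>ln det\<close> by its
  tangent at \<open>Z\<close>, both at the \<open>Z\<close> of each stopping cube \<open>R\<close> and pointwise at \<open>W\<^sup>2 / 2\<close> off the
  stopping cubes, the quadratic term \<open>- X\<^sup>2 / 2\<close> leaves over a variance:
  \<open>\<Sum>\<^sub>R (\<Phi>(R) + \<mu>(R) tr (Z\<inverse> (W\<^sub>R - X)\<^sup>2) / 2) \<le> \<Phi>(Q)\<close>.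

  The hypothesis and Jensen's inequality give \<open>det Y \<le> C2\<^sup>2 det X\<^sup>2\<close>.  All eigenvalues of \<open>Y\<close>
  relative to \<open>X\<^sup>2\<close> are at least 1, hence none exceeds \<open>C2\<^sup>2\<close>, so \<open>Z \<le> C2\<^sup>2 X\<^sup>2\<close> and the trace is at
  least \<open>C2\<^sup>-\<^sup>2 |X\<inverse> W\<^sub>R - I|\<^sup>2 > (\<epsilon>3 / C2)\<^sup>2\<close>.  Summing over the generations telescopes, and
  \<open>0 \<le> \<Phi>(Q) \<le> \<mu>(Q) (ln C2\<^sup>2 + N ln 2)\<close>.
\<close>

section \<open>Positive definite matrices\<close>

lemma symmetric_matrix_dot:
  fixes A :: "real ^ 'n ^ 'n"
  assumes "transpose A = A"
  shows "x \<bullet> (A *v y) = y \<bullet> (A *v x)"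
  by (metis assms dot_lmul_matrix transpose_matrix_vector inner_commute)

text \<open>For small \<open>t\<close> of sign opposite to \<open>b\<close> the linear term
  dominates. This is the first-order condition at a minimum in algebraic form.\<close>

lemma linear_coeff_zero_if_quadratic_nonneg:
  fixes a b :: real
  assumes "\<And>t. 0 \<le> t * b + t\<^sup>2 * a"
  shows "b = 0"
proof (rule ccontr)
  assume b: "b \<noteq> 0"
  \<comment> \<open>Any positive denominator larger than \<open>a\<close> makes the value at
    \<open>- b / c\<close> negative.\<close>
  define c where "c = \<bar>a\<bar> + 1"
  have c: "0 < c" "0 < c - a" by (auto simp: c_def)
  define s where "s = - b / c"
  have "s * b + s\<^sup>2 * a = - (b\<^sup>2 / c\<^sup>2 * (c - a))"
    unfolding s_def using c by (simp add: field_simps power2_eq_square)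
  moreover have "0 < b\<^sup>2 / c\<^sup>2 * (c - a)"
    using b c by simp
  ultimately show False
    using assms[of s] by simp
qed

text \<open>Induction on \<open>n\<close>: a maximiser of the Rayleigh quotient of \<open>B\<close>
  relative to \<open>A\<close> on \<open>V\<close> is conjugate, for both forms, to its
  \<open>A\<close>-orthogonal complement in \<open>V\<close>, where the next vectors are found. The
  complement loses at most one dimension, hence the condition \<open>n \<le> dim V\<close>.\<close>

lemma conjugate_vectors:
  fixes A B :: "real ^ 'n ^ 'n"
  assumes A: "pos_def A" and B: "transpose B = B"
    and "subspace V" "n \<le> dim V"
  shows "\<exists>S\<subseteq>V. finite S \<and> card S = n \<and> (\<forall>x\<in>S. x \<bullet> (A *v x) = 1) \<and>
    (\<forall>x\<in>S. \<forall>y\<in>S. x \<noteq> y \<longrightarrow> x \<bullet> (A *v y) = 0 \<and> x \<bullet> (B *v y) = 0)"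
  using assms(3,4)
proof (induction n arbitrary: V)
  case 0
  show ?case by (intro exI[of _ "{}"]) auto
next
  case (Suc n)
  note symA = symmetric_matrix_dot[of A] and symB = symmetric_matrix_dot[OF B]
  have tA: "transpose A = A" and posA: "\<And>x. x \<noteq> 0 \<Longrightarrow> 0 < x \<bullet> (A *v x)"
    using A by (auto simp: pos_def_def)
  define K where "K = V \<inter> sphere 0 1"
  define r where "r x = (x \<bullet> (B *v x)) / (x \<bullet> (A *v x))" for x
  have "compact K"
    unfolding K_def using closed_subspace[OF Suc.prems(1)] by (simp add: closed_Int_compact)
  moreover have "K \<noteq> {}"
  proof -
    have "\<not> V \<subseteq> {0}"
      using Suc.prems(2) dim_eq_0[of V] by linarith
    then obtain x where "x \<in> V" "x \<noteq> 0" by auto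
    then have "x /\<^sub>R norm x \<in> K"
      using Suc.prems(1) by (auto simp: K_def subspace_scale)
    then show ?thesis by auto
  qed
  moreover have "continuous_on K r"
  proof -
    have "x \<bullet> (A *v x) \<noteq> 0" if "x \<in> K" for x
      using posA[of x] that by (fastforce simp: K_def)
    then show ?thesis
      unfolding r_def by (intro continuous_intros linear_continuous_on_compose) auto
  qed
  ultimately obtain u where u: "u \<in> K" and umax: "\<And>x. x \<in> K \<Longrightarrow> r x \<le> r u"
    using continuous_attains_sup[of K r] by metis
  \<comment> \<open>\<open>g\<close> is a quadratic form, nonnegative on \<open>V\<close> and zero
    at the maximiser \<open>u\<close>, so its first variation at \<open>u\<close> vanishes. That is
    \<open>crit\<close>, the generalised eigenvalue equation for \<open>u\<close> tested against
    \<open>V\<close>.\<close>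
  define g where "g x = r u * (x \<bullet> (A *v x)) - x \<bullet> (B *v x)" for x
  have u0: "u \<noteq> 0" "u \<in> V" using u by (auto simp: K_def)
  have g_nonneg: "0 \<le> g x" if "x \<in> V" for x
  proof (cases "x = 0")
    case False
    define y where "y = x /\<^sub>R norm x"
    have "y \<in> K" "y \<noteq> 0"
      using that False Suc.prems(1) by (auto simp: K_def y_def subspace_scale)
    then have "0 \<le> g y"
      using umax[of y] posA[of y] by (simp add: r_def g_def field_simps)
    moreover have "g x = (norm x)\<^sup>2 * g y"
      using False by (simp add: y_def g_def matrix_vector_mult_scaleR power2_eq_square field_simps)
    ultimately show ?thesis by simp
  qed (simp add: g_def)
  have gu: "g u = 0"
    using posA[OF u0(1)] by (simp add: g_def r_def)
  have crit: "u \<bullet> (B *v w) = r u * (u \<bullet> (A *v w))" if "w \<in> V" for w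
  proof -
    define b where "b = 2 * (r u * (u \<bullet> (A *v w)) - u \<bullet> (B *v w))"
    have "0 \<le> t * b + t\<^sup>2 * g w" for t
    proof -
      have "u + t *\<^sub>R w \<in> V"
        using that u0 Suc.prems(1) by (simp add: subspace_add subspace_scale)
      from g_nonneg[OF this] have "0 \<le> g (u + t *\<^sub>R w)" .
      also have "g (u + t *\<^sub>R w) = g u + t * b + t\<^sup>2 * g w"
        unfolding g_def b_def using symA[OF tA, of w u] symB[of w u]
        by (simp add: matrix_vector_right_distrib matrix_vector_mult_scaleR inner_add_left inner_add_right
            power2_eq_square algebra_simps)
      finally show ?thesis using gu by simp
    qed
    then have "b = 0" by (rule linear_coeff_zero_if_quadratic_nonneg)
    then show ?thesis by (simp add: b_def)
  qed
  define v where "v = u /\<^sub>R sqrt (u \<bullet> (A *v u))"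
  have v: "v \<in> V" "v \<bullet> (A *v v) = 1"
    using u0 Suc.prems(1) posA[OF u0(1)]
    by (auto simp: v_def subspace_scale matrix_vector_mult_scaleR real_sqrt_mult_self field_simps)
  have vcrit: "v \<bullet> (B *v w) = r u * (v \<bullet> (A *v w))" if "w \<in> V" for w
    using crit[OF that] by (simp add: v_def)
  define V' where "V' = {x \<in> V. v \<bullet> (A *v x) = 0}"
  have "subspace V'"
    using Suc.prems(1) unfolding V'_def subspace_def
    by (auto simp: matrix_vector_right_distrib matrix_vector_mult_scaleR inner_add_right)
  moreover have "n \<le> dim V'"
  proof -
    \<comment> \<open>Subtracting the \<open>A\<close>-projection onto \<open>v\<close> lands in
      \<open>V'\<close>.\<close>
    have "V \<subseteq> span (insert v V')"
    proof
      fix x assume x: "x \<in> V"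
      define c where "c = v \<bullet> (A *v x)"
      have "x - c *\<^sub>R v \<in> V'"
        using x v Suc.prems(1) unfolding V'_def c_def
        by (auto simp: matrix_vector_mult_diff_distrib matrix_vector_mult_scaleR inner_diff_right
            subspace_diff subspace_scale)
      then have "(x - c *\<^sub>R v) + c *\<^sub>R v \<in> span (insert v V')"
        by (intro span_add span_scale) (auto intro: span_base)
      then show "x \<in> span (insert v V')" by simp
    qed
    then have "dim V \<le> dim (insert v V')"
      by (metis dim_subset dim_span)
    also have "\<dots> \<le> dim V' + 1" by (simp add: dim_insert)
    finally show ?thesis using Suc.prems(2) by simp
  qed
  ultimately have "\<exists>S\<subseteq>V'. finite S \<and> card S = n \<and> (\<forall>x\<in>S. x \<bullet> (A *v x) = 1) \<and>
    (\<forall>x\<in>S. \<forall>y\<in>S. x \<noteq> y \<longrightarrow> x \<bullet> (A *v y) = 0 \<and> x \<bullet> (B *v y) = 0)"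
    by (rule Suc.IH)
  then obtain S where S: "S \<subseteq> V'" "finite S" "card S = n" "\<forall>x\<in>S. x \<bullet> (A *v x) = 1"
    "\<forall>x\<in>S. \<forall>y\<in>S. x \<noteq> y \<longrightarrow> x \<bullet> (A *v y) = 0 \<and> x \<bullet> (B *v y) = 0"
    by (elim exE conjE)
  have "v \<notin> S" using S(1) v by (auto simp: V'_def)
  \<comment> \<open>By \<open>vcrit\<close>, \<open>A\<close>-orthogonality to \<open>v\<close>
    forces \<open>B\<close>-orthogonality within \<open>V\<close>.\<close>
  moreover have "v \<bullet> (A *v y) = 0" "v \<bullet> (B *v y) = 0" "y \<bullet> (A *v v) = 0" "y \<bullet> (B *v v) = 0"
    if "y \<in> S" for y
    using vcrit[of y] that S(1) symA[OF tA, of y v] symB[of y v] by (auto simp: V'_def)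
  ultimately show ?case
    using S v by (intro exI[of _ "insert v S"]) (auto simp: V'_def)
qed

text \<open>\<open>B\<close> need not be positive: the columns of \<open>P\<close> are successive maximisers of the Rayleigh
  quotient of \<open>B\<close> relative to \<open>A\<close>.\<close>

lemma simultaneous_diagonalisation:
  fixes A B :: "real ^ 'n ^ 'n"
  assumes "pos_def A" and "transpose B = B"
  obtains P :: "real ^ 'n ^ 'n" and d where "transpose P ** A ** P = mat 1"
    and "transpose P ** B ** P = (\<chi> i j. if i = j then d i else 0)"
proof -
  obtain S where S: "finite S" "card S = CARD('n)" "\<forall>x\<in>S. x \<bullet> (A *v x) = 1"
    "\<forall>x\<in>S. \<forall>y\<in>S. x \<noteq> y \<longrightarrow> x \<bullet> (A *v y) = 0 \<and> x \<bullet> (B *v y) = 0"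
    using conjugate_vectors[OF assms subspace_UNIV, of "CARD('n)"] by (auto simp: dim_UNIV)
  obtain f where f: "bij_betw f (UNIV :: 'n set) S"
    using S(1,2) finite_same_card_bij[of "UNIV :: 'n set" S] by auto
  define P :: "real ^ 'n ^ 'n" where "P = (\<chi> i j. f j $ i)"
  have entry: "(transpose P ** M ** P) $ i $ j = f i \<bullet> (M *v f j)"
    for M :: "real ^ 'n ^ 'n" and i j :: 'n
  proof -
    have "(transpose P ** M ** P) $ i $ j = (\<Sum>k\<in>UNIV. \<Sum>l\<in>UNIV. f i $ k * (M $ k $ l * f j $ l))"
      by (simp add: matrix_matrix_mult_def transpose_def P_def sum_distrib_right)
        (subst sum.swap, simp add: mult.assoc)
    also have "\<dots> = f i \<bullet> (M *v f j)"
      by (simp add: inner_vec_def matrix_vector_mult_def sum_distrib_left)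
    finally show ?thesis .
  qed
  have fS: "f i \<in> S" and inj: "f i = f j \<longleftrightarrow> i = j" for i j
    using f by (auto simp: bij_betw_def inj_on_def)
  have off: "f i \<bullet> (A *v f j) = 0" "f i \<bullet> (B *v f j) = 0" if "i \<noteq> j" for i j
    using S(4)[rule_format, OF fS fS, of i j] inj[of i j] that by blast+
  have fA: "f i \<bullet> (A *v f j) = (if i = j then 1 else 0)" for i j
    using off(1)[of i j] S(3)[rule_format, OF fS, of i] by (cases "i = j") simp_all
  show ?thesis
  proof (rule that)
    show "transpose P ** A ** P = mat 1"
      by (simp add: vec_eq_iff entry mat_def fA)
    show "transpose P ** B ** P = (\<chi> i j. if i = j then f i \<bullet> (B *v f i) else 0)"
      by (simp add: vec_eq_iff entry off)
  qed
qed

text \<open>\<open>transpose P\<close> takes the role of an inverse square root of \<open>A\<close>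
  throughout: \<open>P ** transpose P\<close> is the inverse of \<open>A\<close>.\<close>

lemma pos_def_congruent_identity:
  fixes A :: "real ^ 'n ^ 'n"
  assumes "pos_def A"
  obtains P :: "real ^ 'n ^ 'n" where "transpose P ** A ** P = mat 1"
proof -
  have "transpose A = A" using assms by (simp add: pos_def_def)
  from simultaneous_diagonalisation[OF assms this] show ?thesis using that by metis
qed

lemma pos_def_det_pos:
  fixes A :: "real ^ 'n ^ 'n"
  assumes "pos_def A"
  shows "0 < det A"
proof -
  obtain P :: "real ^ 'n ^ 'n" where P: "transpose P ** A ** P = mat 1"
    using pos_def_congruent_identity[OF assms] .
  have "1 = det (transpose P ** A ** P)" by (simp add: P)
  also have "\<dots> = (det P)\<^sup>2 * det A" by (simp add: det_mul power2_eq_square)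
  finally have "0 < (det P)\<^sup>2 * det A" by simp
  then show ?thesis by (auto simp: zero_less_mult_iff)
qed

lemma pos_def_invertible: "pos_def A \<Longrightarrow> invertible A"
  for A :: "real ^ 'n ^ 'n"
  using pos_def_det_pos[of A] by (simp add: invertible_det_nz)

lemma pos_def_mult_nonzero: "pos_def A \<Longrightarrow> v \<noteq> 0 \<Longrightarrow> A *v v \<noteq> 0"
  for A :: "real ^ 'n ^ 'n"
  unfolding pos_def_def by (metis inner_zero_right less_irrefl)

section \<open>Inverses, congruences and the Frobenius norm\<close>

lemma matrix_inv_unique:
  fixes A B :: "real ^ 'n ^ 'n"
  assumes "A ** B = mat 1"
  shows "matrix_inv A = B"
proof -
  have "B ** A = mat 1" using assms matrix_left_right_inverse by blast
  \<comment> \<open>\<open>matrix_inv\<close> is a choice among two-sided inverses, so both products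
    are supplied.\<close>
  moreover have "A ** matrix_inv A = mat 1"
    using assms \<open>B ** A = mat 1\<close> unfolding matrix_inv_def
    by (rule_tac someI2[of _ B]) auto
  ultimately show ?thesis
    by (metis matrix_mul_assoc matrix_mul_lid matrix_mul_rid)
qed

lemma matrix_inv_right:
  fixes A :: "real ^ 'n ^ 'n"
  assumes "invertible A"
  shows "A ** matrix_inv A = mat 1"
proof -
  obtain B where "A ** B = mat 1" using assms by (auto simp: invertible_def)
  then show ?thesis by (simp add: matrix_inv_unique)
qed

lemma matrix_inv_left:
  fixes A :: "real ^ 'n ^ 'n"
  assumes "invertible A"
  shows "matrix_inv A ** A = mat 1"
  using matrix_inv_right[OF assms] matrix_left_right_inverse by blast

lemma congruence_matrix_inv:
  fixes A P :: "real ^ 'n ^ 'n"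
  assumes "transpose P ** A ** P = mat 1"
  shows "matrix_inv A = P ** transpose P"
proof (rule matrix_inv_unique)
  have "(A ** P) ** transpose P = mat 1"
    using assms matrix_left_right_inverse by (metis matrix_mul_assoc)
  then show "A ** (P ** transpose P) = mat 1" by (simp add: matrix_mul_assoc)
qed

lemma trace_congruence:
  fixes P M :: "real ^ 'n ^ 'n"
  shows "trace (P ** transpose P ** M) = trace (transpose P ** M ** P)"
  using trace_mul_sym[of P "transpose P ** M"] by (simp add: matrix_mul_assoc)

text \<open>The norm of the matrix type is the Frobenius norm; the operator norm is
  \<open>onorm\<close>. Traces of squares are later read as such norms.\<close>

lemma norm_matrix_power2: "(norm M)\<^sup>2 = trace (M ** transpose M)"
  for M :: "real ^ 'n ^ 'm"
  by (simp add: power2_norm_eq_inner trace_def matrix_matrix_mult_def transpose_def inner_vec_def)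

text \<open>Cauchy-Schwarz in each row; the Frobenius norm thus dominates the operator norm.\<close>

lemma norm_matrix_vector_mult_le: "norm (M *v x) \<le> norm M * norm x"
  for M :: "real ^ 'n ^ 'm"
proof -
  have "(norm (M *v x))\<^sup>2 = (\<Sum>i\<in>UNIV. ((M $ i) \<bullet> x)\<^sup>2)"
    unfolding power2_norm_eq_inner
    by (subst inner_vec_def) (simp add: matrix_vector_mul_component power2_eq_square)
  also have "\<dots> \<le> (\<Sum>i\<in>UNIV. (norm (M $ i))\<^sup>2 * (norm x)\<^sup>2)"
    by (intro sum_mono) (metis Cauchy_Schwarz_ineq power2_norm_eq_inner)
  also have "\<dots> = (norm M * norm x)\<^sup>2"
    by (simp add: power_mult_distrib sum_distrib_right power2_norm_eq_inner inner_vec_def[of M])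
  finally show ?thesis by (rule power2_le_imp_le) simp
qed

text \<open>Evaluating at the columns of \<open>P\<close> turns inequalities between forms into
  inequalities between relative eigenvalues.\<close>

lemma congruent_diagonal_entry:
  fixes B P :: "real ^ 'n ^ 'n"
  assumes "transpose P ** B ** P = (\<chi> i j. if i = j then d i else 0)"
  shows "d i = (P *v axis i 1) \<bullet> (B *v (P *v axis i 1))"
proof -
  have "(P *v axis i 1) \<bullet> (B *v (P *v axis i 1)) = axis i 1 \<bullet> ((transpose P ** B ** P) *v axis i 1)"
    by (metis dot_lmul_matrix matrix_vector_mul_assoc vector_transpose_matrix)
  also have "\<dots> = (transpose P ** B ** P) $ i $ i"
    by (simp add: inner_axis' matrix_vector_mul_component inner_axis)
  finally show ?thesis by (simp add: assms)
qed

section \<open>Concavity of the logarithmic determinant and trace estimates\<close>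

text \<open>Concavity of \<open>ln det\<close>, as a bound by its tangent at \<open>A\<close>. After
  diagonalising \<open>B\<close> relative to \<open>A\<close> it becomes
  \<open>ln (d i) \<le> d i - 1\<close>, and the \<open>d i\<close> sum to the trace.\<close>

lemma ln_det_tangent:
  fixes A B :: "real ^ 'n ^ 'n"
  assumes A: "pos_def A" and B: "pos_def B"
  shows "ln (det B) \<le> ln (det A) + trace (matrix_inv A ** B) - real CARD('n)"
proof -
  obtain P :: "real ^ 'n ^ 'n" and d where PA: "transpose P ** A ** P = mat 1"
    and PB: "transpose P ** B ** P = (\<chi> i j. if i = j then d i else 0)"
    using B by (auto simp: pos_def_def intro: simultaneous_diagonalisation[OF A])
  have dA: "(det P)\<^sup>2 * det A = 1"
    using arg_cong[OF PA, of det] by (simp add: det_mul power2_eq_square mult_ac)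
  have dB: "(det P)\<^sup>2 * det B = (\<Prod>i\<in>UNIV. d i)"
    using arg_cong[OF PB, of det] by (simp add: det_mul det_diagonal power2_eq_square mult_ac)
  have "invertible P" using dA by (auto simp: invertible_det_nz)
  have pos: "0 < d i" for i
  proof -
    have "P *v axis i 1 \<noteq> 0"
      using \<open>invertible P\<close>
      by (metis axis_eq_0_iff invertible_def matrix_vector_mul_assoc matrix_vector_mul_lid
          matrix_vector_mult_0_right one_neq_zero)
    then show ?thesis
      using B congruent_diagonal_entry[OF PB, of i] by (simp add: pos_def_def)
  qed
  \<comment> \<open>The unknown factor \<open>(det P)\<^sup>2\<close> cancels in the
    quotient.\<close>
  have "det B / det A = (\<Prod>i\<in>UNIV. d i)"
  proof -
    have "det B = det B * ((det P)\<^sup>2 * det A)" by (simp add: dA)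
    also have "\<dots> = (\<Prod>i\<in>UNIV. d i) * det A" by (simp flip: dB)
    finally show ?thesis using pos_def_det_pos[OF A] by (simp add: field_simps)
  qed
  moreover have "ln (det B) - ln (det A) = ln (det B / det A)"
    using pos_def_det_pos[OF A] pos_def_det_pos[OF B] by (simp add: ln_div)
  ultimately have "ln (det B) - ln (det A) = ln (\<Prod>i\<in>UNIV. d i)"
    by (simp only:)
  also have "\<dots> = (\<Sum>i\<in>UNIV. ln (d i))"
    using less_imp_neq[OF pos, symmetric] by (intro ln_prod) auto
  also have "\<dots> \<le> (\<Sum>i\<in>UNIV. d i - 1)"
    using pos by (intro sum_mono ln_le_minus_one) auto
  also have "\<dots> = trace (transpose P ** B ** P) - real CARD('n)"
    by (simp add: PB trace_def sum_subtractf)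
  also have "trace (transpose P ** B ** P) = trace (matrix_inv A ** B)"
    by (simp add: congruence_matrix_inv[OF PA] trace_congruence)
  finally show ?thesis by simp
qed

text \<open>The eigenvalues of \<open>B\<close> relative to \<open>A\<close> are at least 1 and
  their product is at most \<open>K\<close>, so dropping all factors but one bounds each of them by
  \<open>K\<close>.\<close>

lemma quadratic_form_le_det_quotient:
  fixes A B :: "real ^ 'n ^ 'n"
  assumes A: "pos_def A" and B: "transpose B = B"
    and le: "\<And>v. v \<bullet> (A *v v) \<le> v \<bullet> (B *v v)" and det: "det B \<le> K * det A"
  shows "v \<bullet> (B *v v) \<le> K * (v \<bullet> (A *v v))"
proof -
  obtain P :: "real ^ 'n ^ 'n" and d where PA: "transpose P ** A ** P = mat 1"
    and PB: "transpose P ** B ** P = (\<chi> i j. if i = j then d i else 0)"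
    by (rule simultaneous_diagonalisation[OF A B])
  have dA: "(det P)\<^sup>2 * det A = 1"
    using arg_cong[OF PA, of det] by (simp add: det_mul power2_eq_square mult_ac)
  have dB: "(det P)\<^sup>2 * det B = (\<Prod>i\<in>UNIV. d i)"
    using arg_cong[OF PB, of det] by (simp add: det_mul det_diagonal power2_eq_square mult_ac)
  have "invertible P" using dA by (auto simp: invertible_det_nz)
  then obtain P' where P': "P ** P' = mat 1" by (auto simp: invertible_def)
  \<comment> \<open>Written as a diagonal matrix, the identity fits
    \<open>congruent_diagonal_entry\<close>, which then compares \<open>1\<close> with
    \<open>d i\<close>.\<close>
  have PA': "transpose P ** A ** P = (\<chi> i j. if i = j then 1 else 0)"
    by (simp add: PA mat_def)
  have ge1: "1 \<le> d i" for i
    using congruent_diagonal_entry[OF PB, of i] congruent_diagonal_entry[OF PA', of i] le by metis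
  have "(\<Prod>i\<in>UNIV. d i) \<le> K"
    using mult_left_mono[OF det, of "(det P)\<^sup>2"] dA dB by (simp add: mult.left_commute)
  moreover have "d i \<le> (\<Prod>i\<in>UNIV. d i)" for i
  proof -
    have "d i * 1 \<le> d i * (\<Prod>i\<in>UNIV - {i}. d i)"
      using ge1[of i] by (intro mult_left_mono prod_ge_1 ge1) auto
    also have "\<dots> = (\<Prod>i\<in>UNIV. d i)" by (simp add: prod.remove[of UNIV i])
    finally show ?thesis by simp
  qed
  ultimately have dK: "d i \<le> K" for i by (meson order_trans)
  define u where "u = P' *v v"
  have v: "v = P *v u" by (simp add: u_def matrix_vector_mul_assoc P')
  have form: "v \<bullet> (M *v v) = u \<bullet> ((transpose P ** M ** P) *v u)" for M
    unfolding v by (metis dot_lmul_matrix matrix_vector_mul_assoc vector_transpose_matrix)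
  have "v \<bullet> (B *v v) = (\<Sum>i\<in>UNIV. d i * (u $ i)\<^sup>2)"
    unfolding form PB
    by (simp add: inner_vec_def matrix_vector_mult_def if_distrib if_distribR power2_eq_square mult_ac
        cong: if_cong)
  also have "\<dots> \<le> (\<Sum>i\<in>UNIV. K * (u $ i)\<^sup>2)"
    using dK by (intro sum_mono mult_right_mono) auto
  also have "\<dots> = K * (v \<bullet> (A *v v))"
    unfolding form PA by (simp add: inner_vec_def sum_distrib_left power2_eq_square)
  finally show ?thesis .
qed

text \<open>With \<open>transpose P\<close> as inverse square root of \<open>Z\<close>, the trace is
  a squared Frobenius norm.\<close>

lemma trace_inv_square:
  fixes Z D P :: "real ^ 'n ^ 'n"
  assumes P: "transpose P ** Z ** P = mat 1" and D: "transpose D = D"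
  shows "trace (matrix_inv Z ** (D ** D)) = (norm (transpose P ** D))\<^sup>2"
  unfolding norm_matrix_power2 congruence_matrix_inv[OF P] trace_congruence
  by (simp add: matrix_transpose_mul D matrix_mul_assoc)

lemma trace_inv_square_nonneg:
  fixes Z D :: "real ^ 'n ^ 'n"
  assumes Z: "pos_def Z" and D: "transpose D = D"
  shows "0 \<le> trace (matrix_inv Z ** (D ** D))"
proof -
  obtain P :: "real ^ 'n ^ 'n" where "transpose P ** Z ** P = mat 1"
    using pos_def_congruent_identity[OF Z] .
  then show ?thesis using trace_inv_square[OF _ D] by simp
qed

text \<open>Inverting the order of forms, \<open>Z \<le> K X^2\<close> yields
  \<open>X^-2 \<le> K Z^-1\<close>; the Frobenius norm then bounds the operator norm. This converts
  the stopping criterion into a lower bound for the trace gained by the potential.\<close>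

lemma trace_inv_square_ge_onorm:
  fixes X Z D :: "real ^ 'n ^ 'n"
  assumes X: "pos_def X" and Z: "pos_def Z" and D: "transpose D = D"
    and le: "\<And>v. v \<bullet> (Z *v v) \<le> K * (norm (X *v v))\<^sup>2" and K: "0 \<le> K"
  shows "(onorm ((*v) (matrix_inv X ** D)))\<^sup>2 \<le> K * trace (matrix_inv Z ** (D ** D))"
proof -
  obtain P :: "real ^ 'n ^ 'n" where P: "transpose P ** Z ** P = mat 1"
    using pos_def_congruent_identity[OF Z] .
  have inv: "Z ** (P ** transpose P) = mat 1" "X ** matrix_inv X = mat 1" 
    using matrix_inv_right[OF pos_def_invertible[OF X]] matrix_inv_right[OF pos_def_invertible[OF Z]]
    by (simp_all flip: congruence_matrix_inv[OF P])
  have inv': "P ** transpose P ** Z = mat 1"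
    using inv(1) matrix_left_right_inverse by blast
  have sX: "transpose X = X" and sZ: "transpose Z = Z" using X Z by (auto simp: pos_def_def)
  \<comment> \<open>With \<open>w = X^-1 u\<close> and \<open>q = X^-2 u\<close>, Cauchy-Schwarz
    bounds \<open>|w|^2 = u \<bullet> q\<close> by the norms of \<open>transpose P *v u\<close> and
    \<open>transpose P *v (Z *v q)\<close>; the hypothesis \<open>le\<close> at \<open>q\<close>
    bounds the latter by \<open>sqrt K * norm w\<close>.\<close>
  have key: "norm (matrix_inv X *v u) \<le> sqrt K * norm (transpose P *v u)" for u
  proof -
    define w where "w = matrix_inv X *v u"
    define q where "q = matrix_inv X *v w"
    have u: "u = X *v w" and w: "w = X *v q"
      by (simp_all add: w_def q_def matrix_vector_mul_assoc inv matrix_mul_assoc)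
    have "(norm (transpose P *v (Z *v q)))\<^sup>2 = q \<bullet> ((Z ** (P ** transpose P) ** Z) *v q)"
      unfolding power2_norm_eq_inner
      by (metis dot_lmul_matrix matrix_vector_mul_assoc vector_transpose_matrix sZ transpose_transpose)
    also have "\<dots> = q \<bullet> (Z *v q)" by (simp add: inv)
    also have "\<dots> \<le> K * (norm w)\<^sup>2" using le[of q] by (simp add: w)
    also have "\<dots> = (sqrt K * norm w)\<^sup>2" using K by (simp add: power_mult_distrib)
    finally have 1: "norm (transpose P *v (Z *v q)) \<le> sqrt K * norm w"
      by (rule power2_le_imp_le) (simp add: K)
    have "(norm w)\<^sup>2 = u \<bullet> q"
      unfolding power2_norm_eq_inner using symmetric_matrix_dot[OF sX, of w q] u w
      by (metis inner_commute)
    also have "\<dots> = u \<bullet> ((P ** transpose P ** Z) *v q)" by (simp add: inv')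
    also have "\<dots> = (transpose P *v u) \<bullet> (transpose P *v (Z *v q))"
      by (metis dot_lmul_matrix matrix_vector_mul_assoc transpose_matrix_vector)
    also have "\<dots> \<le> norm (transpose P *v u) * norm (transpose P *v (Z *v q))"
      by (rule norm_cauchy_schwarz)
    also have "\<dots> \<le> norm (transpose P *v u) * (sqrt K * norm w)"
      by (intro mult_left_mono 1) auto
    finally have "norm w * norm w \<le> (sqrt K * norm (transpose P *v u)) * norm w"
      by (simp add: power2_eq_square mult_ac)
    then show ?thesis
      unfolding w_def[symmetric] using K
      by (cases "w = 0") (simp_all del: transpose_matrix_vector)
  qed
  have "onorm ((*v) (matrix_inv X ** D)) \<le> sqrt K * norm (transpose P ** D)"
  proof (rule onorm_le)
    fix x :: "real ^ 'n"
    have "norm ((matrix_inv X ** D) *v x) \<le> sqrt K * norm (transpose P *v (D *v x))"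
      using key[of "D *v x"] by (simp add: matrix_vector_mul_assoc)
    also have "\<dots> = sqrt K * norm ((transpose P ** D) *v x)"
      by (metis matrix_vector_mul_assoc)
    also have "\<dots> \<le> sqrt K * (norm (transpose P ** D) * norm x)"
      by (intro mult_left_mono norm_matrix_vector_mult_le) (simp add: K)
    finally show "norm ((matrix_inv X ** D) *v x) \<le> sqrt K * norm (transpose P ** D) * norm x"
      by simp
  qed
  then have "(onorm ((*v) (matrix_inv X ** D)))\<^sup>2 \<le> (sqrt K * norm (transpose P ** D))\<^sup>2"
    by (intro power_mono onorm_pos_le) (auto simp: matrix_vector_mul_bounded_linear)
  then show ?thesis
    using K by (simp add: power_mult_distrib trace_inv_square[OF P D])
qed

section \<open>Matrix algebra and linear functionals of matrices\<close>

lemma matrix_mul_diff_left: "(A - B) ** C = A ** C - B ** C"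
  for A B :: "real ^ 'n ^ 'm" and C :: "real ^ 'k ^ 'n"
  by (simp add: matrix_matrix_mult_def vec_eq_iff left_diff_distrib sum_subtractf)

lemma matrix_mul_diff_right: "C ** (A - B) = C ** A - C ** B"
  for A B :: "real ^ 'n ^ 'm" and C :: "real ^ 'm ^ 'k"
  by (simp add: matrix_matrix_mult_def vec_eq_iff right_diff_distrib sum_subtractf)

lemma transpose_diff: "transpose (A - B) = transpose A - transpose B"
  for A B :: "real ^ 'n ^ 'm"
  by (simp add: transpose_def vec_eq_iff)

lemma trace_scaleR: "trace (c *\<^sub>R A) = c * trace A" for A :: "real ^ 'n ^ 'n"
  by (simp add: trace_def sum_distrib_left)

lemma matrix_mul_scaleR_right: "A ** (c *\<^sub>R B) = c *\<^sub>R (A ** B)"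
  for A :: "real ^ 'n ^ 'm" and B :: "real ^ 'k ^ 'n"
  by (simp add: matrix_matrix_mult_def vec_eq_iff sum_distrib_left mult_ac)

text \<open>Matrix averages are reached through bounded linear maps, which commute with the Bochner
  integral. This functional, the bilinear forms and the transpose are the ones used.\<close>

lemma bounded_linear_trace_mult: "bounded_linear (\<lambda>M. trace (T ** M))"
  for T :: "real ^ 'n ^ 'n"
  unfolding linear_conv_bounded_linear[symmetric]
  by (rule linearI) (simp_all add: matrix_add_ldistrib matrix_mul_scaleR_right trace_add trace_scaleR)

lemma bounded_linear_bilinear_form: "bounded_linear (\<lambda>M. u \<bullet> (M *v v))"
  for u :: "real ^ 'm" and v :: "real ^ 'n"
  unfolding linear_conv_bounded_linear[symmetric]
  by (rule linearI) (simp_all add: matrix_vector_mult_add_rdistrib inner_add_right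
      scaleR_matrix_vector_assoc[symmetric])

lemma bounded_linear_transpose: "bounded_linear (transpose :: real ^ 'n ^ 'm \<Rightarrow> _)"
  unfolding linear_conv_bounded_linear[symmetric]
  by (rule linearI) (simp_all add: transpose_def vec_eq_iff)

lemma transpose_square: "transpose A = A \<Longrightarrow> transpose (A ** A) = A ** A"
  for A :: "real ^ 'n ^ 'n"
  by (simp add: matrix_transpose_mul)

lemma quadratic_form_square:
  fixes A :: "real ^ 'n ^ 'n"
  assumes "transpose A = A"
  shows "v \<bullet> ((A ** A) *v v) = (norm (A *v v))\<^sup>2"
  unfolding power2_norm_eq_inner using symmetric_matrix_dot[OF assms, of v "A *v v"]
  by (simp add: matrix_vector_mul_assoc)

lemma pos_def_square:
  fixes A :: "real ^ 'n ^ 'n"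
  assumes "pos_def A"
  shows "pos_def (A ** A)"
proof -
  have "A *v v \<noteq> 0" if "v \<noteq> 0" for v
    using pos_def_mult_nonzero[OF assms that] .
  then show ?thesis
    using assms by (simp add: pos_def_def transpose_square quadratic_form_square)
qed

lemma pos_def_scaleR: "pos_def A \<Longrightarrow> 0 < c \<Longrightarrow> pos_def (c *\<^sub>R A)"
  by (simp add: pos_def_def transpose_scalar flip: scaleR_matrix_vector_assoc)

lemma det_scaleR: "det (c *\<^sub>R A) = c ^ CARD('n) * det A" for A :: "real ^ 'n ^ 'n"
proof -
  have "c *\<^sub>R A = (c *\<^sub>R mat 1) ** A" by (simp flip: scalar_matrix_assoc)
  moreover have "det (c *\<^sub>R mat 1 :: real ^ 'n ^ 'n) = c ^ CARD('n)"
    by (subst det_diagonal) (auto simp: mat_def)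
  ultimately show ?thesis by (simp add: det_mul)
qed

lemma ln_det_half:
  fixes A :: "real ^ 'n ^ 'n"
  assumes "0 < det A"
  shows "ln (det ((1 / 2) *\<^sub>R A)) = ln (det A) - real CARD('n) * ln 2"
  using assms unfolding det_scaleR
  by (subst ln_mult_pos) (simp_all add: ln_realpow ln_div)

section \<open>Averages\<close>

lemma set_integrable_bounded_linear:
  assumes "bounded_linear T" "set_integrable M A f"
  shows "set_integrable M A (\<lambda>x. T (f x))"
  using integrable_bounded_linear[OF assms[unfolded set_integrable_def]]
  by (simp add: set_integrable_def linear_simps(5)[OF assms(1)])

lemma average_bounded_linear:
  assumes "bounded_linear T" "set_integrable M A f"
  shows "T (average M A f) = average M A (\<lambda>x. T (f x))"
  using integral_bounded_linear[OF assms[unfolded set_integrable_def]]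
  by (simp add: average_def set_lebesgue_integral_def linear_simps(5)[OF assms(1)])

lemma set_integrable_const:
  "A \<in> sets M \<Longrightarrow> emeasure M A < \<infinity> \<Longrightarrow> set_integrable M A (\<lambda>x. c)"
  unfolding set_integrable_def by (simp add: integrable_scaleR_left)

text \<open>Shaped for a constant plus linear functionals of \<open>W x ** W x\<close> and
  \<open>W x\<close>, which is what variances and tangent bounds expand to.\<close>

lemma set_integrable_affine:
  fixes a :: real
  assumes A: "A \<in> sets M" "emeasure M A < \<infinity>"
    and S: "bounded_linear S" "set_integrable M A f" and T: "bounded_linear T" "set_integrable M A g"
  shows "set_integrable M A (\<lambda>x. a + S (f x) + T (g x))"
  by (intro set_integral_add set_integrable_const A set_integrable_bounded_linear[OF S]
      set_integrable_bounded_linear[OF T])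

lemma average_affine:
  fixes a :: real
  assumes A: "A \<in> sets M" "emeasure M A < \<infinity>" "0 < measure M A"
    and S: "bounded_linear S" "set_integrable M A f" and T: "bounded_linear T" "set_integrable M A g"
  shows "average M A (\<lambda>x. a + S (f x) + T (g x)) = a + S (average M A f) + T (average M A g)"
proof -
  have "(LINT x:A|M. a + S (f x) + T (g x)) = (LINT x:A|M. a) + (LINT x:A|M. S (f x)) + (LINT x:A|M. T (g x))"
    by (intro set_integral_add(2)[THEN trans] arg_cong2[where f = "(+)"] refl set_integral_add set_integrable_const A
        set_integrable_bounded_linear[OF S] set_integrable_bounded_linear[OF T])
  moreover have "(LINT x:A|M. a) = measure M A * a"
    using A by (simp add: set_lebesgue_integral_def)
  ultimately show ?thesis
    using A(3) unfolding average_bounded_linear[OF S] average_bounded_linear[OF T]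
    by (simp add: average_def field_simps)
qed

section \<open>Positivity, monotonicity and additivity of integrals\<close>

text \<open>A nonnegative function with zero integral vanishes almost everywhere, which here would
  make \<open>A\<close> a null set. The strict sign is what keeps averages of positive definite
  matrices positive definite.\<close>

lemma set_integral_pos:
  fixes f :: "'a \<Rightarrow> real"
  assumes f: "set_integrable M A f" and A: "A \<in> sets M" "0 < measure M A"
    and pos: "AE x in M. x \<in> A \<longrightarrow> 0 < f x"
  shows "0 < (LINT x:A|M. f x)"
proof -
  have nn: "AE x in M. 0 \<le> indicator A x *\<^sub>R f x"
    using pos by eventually_elim (auto simp: indicator_def)
  have "(LINT x:A|M. f x) \<noteq> 0"
  proof
    assume "(LINT x:A|M. f x) = 0"
    then have "AE x in M. indicator A x *\<^sub>R f x = 0"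
      using integral_nonneg_eq_0_iff_AE[OF f[unfolded set_integrable_def] nn]
      by (simp add: set_lebesgue_integral_def)
    with pos have "AE x in M. x \<notin> A"
      by eventually_elim (auto simp: indicator_def split: if_splits)
    then have "A \<in> null_sets M"
      using A(1) by (simp add: AE_iff_null_sets)
    then show False using A(2) by (simp add: measure_def null_setsD1)
  qed
  moreover have "0 \<le> (LINT x:A|M. f x)"
    unfolding set_lebesgue_integral_def by (rule integral_nonneg_AE[OF nn])
  ultimately show ?thesis by simp
qed

lemma average_pos:
  fixes f :: "'a \<Rightarrow> real"
  assumes "set_integrable M A f" "A \<in> sets M" "0 < measure M A" "AE x in M. x \<in> A \<longrightarrow> 0 < f x"
  shows "0 < average M A f"
  using set_integral_pos[OF assms] assms(3) by (simp add: average_def)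

lemma average_nonneg:
  fixes f :: "'a \<Rightarrow> real"
  assumes "AE x in M. x \<in> A \<longrightarrow> 0 \<le> f x"
  shows "0 \<le> average M A f"
proof -
  have "AE x in M. 0 \<le> indicator A x *\<^sub>R f x"
    using assms by eventually_elim (auto simp: indicator_def)
  then show ?thesis
    unfolding average_def set_lebesgue_integral_def by (simp add: integral_nonneg_AE)
qed

lemma average_mono:
  fixes f g :: "'a \<Rightarrow> real"
  assumes "set_integrable M A f" "set_integrable M A g" "AE x in M. x \<in> A \<longrightarrow> f x \<le> g x"
  shows "average M A f \<le> average M A g"
proof -
  have "0 \<le> average M A (\<lambda>x. g x - f x)"
    using assms(3) by (intro average_nonneg) auto
  then show ?thesis
    using assms(1,2) by (simp add: average_def diff_divide_distrib)
qed

lemma sum_set_integral_le: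
  fixes f :: "'a \<Rightarrow> real"
  assumes "finite F" "disjoint F" "\<And>R. R \<in> F \<Longrightarrow> R \<in> sets M \<and> R \<subseteq> A" "A \<in> sets M"
    and f: "set_integrable M A f" and nn: "AE x in M. x \<in> A \<longrightarrow> 0 \<le> f x"
  shows "(\<Sum>R\<in>F. LINT x:R|M. f x) \<le> (LINT x:A|M. f x)"
proof -
  have fR: "set_integrable M R f" if "R \<in> F" for R
    using assms(3)[OF that] by (intro set_integrable_subset[OF f]) auto
  have "(\<Sum>R\<in>F. LINT x:R|M. f x) = (LINT x|M. (\<Sum>R\<in>F. indicator R x *\<^sub>R f x))"
    unfolding set_lebesgue_integral_def
    by (rule Bochner_Integration.integral_sum[symmetric]) (use fR in \<open>simp add: set_integrable_def\<close>)
  also have "\<dots> \<le> (LINT x:A|M. f x)"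
    unfolding set_lebesgue_integral_def
  proof (rule integral_mono_AE)
    show "integrable M (\<lambda>x. \<Sum>R\<in>F. indicator R x *\<^sub>R f x)"
      by (rule Bochner_Integration.integrable_sum) (use fR in \<open>simp add: set_integrable_def\<close>)
    show "integrable M (\<lambda>x. indicator A x *\<^sub>R f x)"
      using f by (simp add: set_integrable_def)
    show "AE x in M. (\<Sum>R\<in>F. indicator R x *\<^sub>R f x) \<le> indicator A x *\<^sub>R f x"
      using nn
    proof eventually_elim
      case (elim x)
      \<comment> \<open>By disjointness at most one summand is nonzero at each point.\<close>
      have eq: "(\<Sum>R\<in>F. indicator R x *\<^sub>R f x) = indicator (\<Union>F) x * f x"
        using assms(1,2) indicator_UN_disjoint[of F id x, where ?'c = real]
        by (simp add: disjoint_family_on_def disjoint_def flip: sum_distrib_right)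
      have "\<Union>F \<subseteq> A" using assms(3) by auto
      then show ?case
        unfolding eq using elim by (auto simp: indicator_def)
    qed
  qed
  finally show ?thesis .
qed

text \<open>The zero measure is doubling, so null cubes have to be treated; averages over them are 0
  by division by zero.\<close>

lemma set_integral_measure_zero:
  assumes "A \<in> sets M" "emeasure M A < \<infinity>" "measure M A = 0"
  shows "(LINT x:A|M. f x) = 0"
proof -
  have "A \<in> null_sets M"
    using assms by (intro null_setsI) (simp_all add: emeasure_eq_ennreal_measure less_top)
  then have "AE x in M. indicator A x *\<^sub>R f x = 0"
    using AE_not_in by (auto elim!: eventually_mono dest!: AE_not_in)
  then show ?thesis
    unfolding set_lebesgue_integral_def by (rule integral_eq_zero_AE)
qed

text \<open>Symmetry is known only almost everywhere, so the transpose is moved inside the integral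
  and the integrands are compared up to a null set.\<close>

lemma average_transpose:
  fixes F :: "'a \<Rightarrow> real ^ 'n ^ 'n"
  assumes "set_integrable \<mu> Q F" "AE x in \<mu>. transpose (F x) = F x"
  shows "transpose (average \<mu> Q F) = average \<mu> Q F"
proof -
  have "(LINT x:Q|\<mu>. transpose (F x)) = (LINT x:Q|\<mu>. F x)"
    unfolding set_lebesgue_integral_def
  proof (rule integral_cong_AE)
    show m: "(\<lambda>x. indicator Q x *\<^sub>R F x) \<in> borel_measurable \<mu>"
      using assms(1) by (simp add: set_integrable_def borel_measurable_integrable)
    show "(\<lambda>x. indicator Q x *\<^sub>R transpose (F x)) \<in> borel_measurable \<mu>"
      using set_integrable_bounded_linear[OF bounded_linear_transpose assms(1)]
      by (simp add: set_integrable_def borel_measurable_integrable)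
    show "AE x in \<mu>. indicator Q x *\<^sub>R transpose (F x) = indicator Q x *\<^sub>R F x"
      using assms(2) by eventually_elim simp
  qed
  then show ?thesis
    unfolding average_bounded_linear[OF bounded_linear_transpose assms(1)] by (simp add: average_def)
qed

section \<open>Dyadic cubes and stopping generations\<close>

lemma dyadic_cube_is_cube:
  assumes "Q \<in> dyadic_cubes"
  obtains c l where "0 < l" "Q = cube c l"
proof -
  obtain k and m :: "int ^ 'a" where Q:
    "Q = {x. \<forall>i. of_int (m $ i) * 2 powi k \<le> x $ i \<and> x $ i < (of_int (m $ i) + 1) * 2 powi k}"
    using assms by (auto simp: dyadic_cubes_def)
  have "Q = cube (\<chi> i. (of_int (m $ i) + 1 / 2) * 2 powi k) (2 powi k)"
    unfolding Q cube_def by (simp add: algebra_simps)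
  then show ?thesis using that[of "2 powi k"] by simp
qed

lemma cube_borel: "cube c l \<in> sets borel"
proof -
  have "cube c l = (\<Inter>i. {x. c $ i - l / 2 \<le> x $ i} \<inter> {x. x $ i < c $ i + l / 2})"
    by (auto simp: cube_def)
  also have "\<dots> \<in> sets borel"
    by (intro sets.countable_INT'' sets.Int borel_closed borel_open closed_Collect_le open_Collect_less
        continuous_intros) auto
  finally show ?thesis .
qed

text \<open>The endpoints of the coarser cube are integer multiples of the finer sidelength, so no
  finer cube straddles them.\<close>

lemma dyadic_cubes_nested:
  assumes "Q \<in> dyadic_cubes" "R \<in> dyadic_cubes" "Q \<inter> R \<noteq> {}"
  shows "Q \<subseteq> R \<or> R \<subseteq> Q"
proof -
  define E where "E k m = {x :: real ^ 'a. \<forall>i. of_int (m $ i) * 2 powi k \<le> x $ i \<and>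
    x $ i < (of_int (m $ i) + 1) * 2 powi k}" for k and m :: "int ^ 'a"
  have nested: "E k m \<subseteq> E k' m'" if k: "k \<le> k'" and x: "x \<in> E k m" "x \<in> E k' m'" for k k' m m' x
  proof -
    \<comment> \<open>The ratio of the sidelengths, an integer because
      \<open>k \<le> k'\<close>.\<close>
    define N :: int where "N = 2 ^ nat (k' - k)"
    define p :: real where "p = 2 powi k"
    have p: "0 < p" by (simp add: p_def)
    have pk': "2 powi k' = of_int N * p"
      using k by (simp add: N_def p_def flip: power_int_add power_int_of_nat)
    \<comment> \<open>The common point \<open>x\<close> gives strict inequalities between integers,
      and integrality sharpens each by one unit.\<close>
    have "m' $ i * N \<le> m $ i \<and> m $ i + 1 \<le> (m' $ i + 1) * N" for i
    proof -
      have "of_int (m' $ i * N) * p \<le> x $ i" "x $ i < of_int (m $ i + 1) * p"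
        "of_int (m $ i) * p \<le> x $ i" "x $ i < of_int ((m' $ i + 1) * N) * p"
        using x unfolding E_def pk' p_def[symmetric] by (auto simp: mult.assoc)
      then have "of_int (m' $ i * N) * p < of_int (m $ i + 1) * p"
        "of_int (m $ i) * p < of_int ((m' $ i + 1) * N) * p"
        by linarith+
      then show ?thesis
        using p by (simp add: mult_less_cancel_right_disj del: of_int_mult of_int_add)
    qed
    then have le: "of_int (m' $ i * N) * p \<le> of_int (m $ i) * p"
      "of_int (m $ i + 1) * p \<le> of_int ((m' $ i + 1) * N) * p" for i
      using p by (intro mult_right_mono; simp del: of_int_mult of_int_add)+
    show ?thesis
    proof
      fix y assume "y \<in> E k m"
      then have "of_int (m $ i) * p \<le> y $ i" "y $ i < of_int (m $ i + 1) * p" for i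
        unfolding E_def p_def[symmetric] by auto
      then have "of_int (m' $ i * N) * p \<le> y $ i" "y $ i < of_int ((m' $ i + 1) * N) * p" for i
        using le[of i] by (meson order_trans less_le_trans)+
      then show "y \<in> E k' m'"
        unfolding E_def pk' by (simp add: mult.assoc)
    qed
  qed
  obtain k m k' m' where QR: "Q = E k m" "R = E k' m'"
    using assms(1,2) unfolding dyadic_cubes_def E_def by blast
  obtain x where "x \<in> E k m" "x \<in> E k' m'" using assms(3) QR by auto
  then show ?thesis
    unfolding QR using nested by (meson linear)
qed

text \<open>Overlapping dyadic cubes are nested, and maximality excludes strict inclusion.\<close>

lemma maximal_subcubes_disjoint: "disjoint (maximal_subcubes P Q)"
proof (rule disjointI)
  fix R S assume RS: "R \<in> maximal_subcubes P Q" "S \<in> maximal_subcubes P Q" "R \<noteq> S"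
  have "R \<subseteq> S \<or> S \<subseteq> R" if "R \<inter> S \<noteq> {}"
    using RS that by (intro dyadic_cubes_nested) (auto simp: maximal_subcubes_def)
  then show "R \<inter> S = {}"
    using RS unfolding maximal_subcubes_def by blast
qed

section \<open>Telescoping over the generations of stopping cubes\<close>

text \<open>The recursion adds generations at the end, whereas the telescoping induction peels off
  the first one.\<close>

lemma generation_Suc_first:
  "generation B (Suc k) Q = (\<Union>R\<in>B Q. generation B k R)"
  by (induction k) auto

text \<open>\<open>m Q\<close> pays for \<open>Q\<close> itself and \<open>\<Phi> Q\<close> for all
  other members of \<open>F\<close>: by \<open>step\<close> it covers the budget
  \<open>\<Phi> R + m R\<close> of every child involved.\<close>

lemma sum_generations_le:
  fixes \<Phi> m :: "'a set \<Rightarrow> real"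
  assumes sub: "\<And>Q. Q \<in> D \<Longrightarrow> B Q \<subseteq> D"
    and m: "\<And>Q. Q \<in> D \<Longrightarrow> 0 \<le> m Q"
    and step: "\<And>Q F. Q \<in> D \<Longrightarrow> finite F \<Longrightarrow> F \<subseteq> B Q \<Longrightarrow> (\<Sum>R\<in>F. \<Phi> R + m R) \<le> \<Phi> Q"
    and Q: "Q \<in> D" and F: "finite F" "F \<subseteq> all_generations B Q"
  shows "(\<Sum>R\<in>F. m R) \<le> \<Phi> Q + m Q"
proof -
  have bound: "(\<Sum>R\<in>F. m R) \<le> \<Phi> Q + m Q"
    if "Q \<in> D" "finite F" "F \<subseteq> (\<Union>k<n. generation B k Q)" for n Q F
    using that
  proof (induction n arbitrary: Q F)
    case 0
    \<comment> \<open>The empty family in \<open>step\<close> gives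
      \<open>0 \<le> \<Phi> Q\<close>.\<close>
    then show ?case using step[of Q "{}"] m[of Q] by simp
  next
    case (Suc n)
    define F' where "F' = F - {Q}"
    have "\<exists>R\<in>B Q. S \<in> (\<Union>k<n. generation B k R)" if S: "S \<in> F'" for S
    proof -
      obtain k where k: "k < Suc n" "S \<in> generation B k Q"
        using subsetD[OF Suc.prems(3), of S] S by (auto simp: F'_def)
      moreover have "k \<noteq> 0" using k S by (auto simp: F'_def intro!: notI)
      ultimately obtain j where "k = Suc j" "j < n" by (cases k) auto
      with k(2) obtain R where "R \<in> B Q" "S \<in> generation B j R"
        by (auto simp: generation_Suc_first simp del: generation.simps)
      with \<open>j < n\<close> show ?thesis by blast
    qed
    \<comment> \<open>\<open>r\<close> assigns each remaining set to one child of \<open>Q\<close>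
      that has it among its first \<open>n\<close> generations. The fibres of \<open>r\<close>
      partition \<open>F'\<close>, and the induction hypothesis applies to each.\<close>
    then have "\<forall>S\<in>F'. \<exists>R. R \<in> B Q \<and> S \<in> (\<Union>k<n. generation B k R)" by blast
    from bchoice[OF this] obtain r
      where r: "\<And>S. S \<in> F' \<Longrightarrow> r S \<in> B Q \<and> S \<in> (\<Union>k<n. generation B k (r S))"
      by auto
    have fin: "finite F'" using Suc.prems(2) by (simp add: F'_def)
    have "(\<Sum>S\<in>F'. m S) = (\<Sum>R\<in>r ` F'. \<Sum>S\<in>{S \<in> F'. r S = R}. m S)"
      by (rule sum.image_gen[OF fin])
    also have "\<dots> \<le> (\<Sum>R\<in>r ` F'. \<Phi> R + m R)"
    proof (intro sum_mono Suc.IH)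
      fix R assume R: "R \<in> r ` F'"
      show "R \<in> D" using R r sub[OF Suc.prems(1)] by blast
      show "{S \<in> F'. r S = R} \<subseteq> (\<Union>k<n. generation B k R)" using r by blast
    qed (use fin in auto)
    also have "\<dots> \<le> \<Phi> Q"
      using r fin by (intro step Suc.prems(1)) auto
    finally have "(\<Sum>S\<in>F'. m S) \<le> \<Phi> Q" .
    moreover have "(\<Sum>S\<in>F. m S) \<le> (\<Sum>S\<in>F'. m S) + m Q"
      using Suc.prems(1,2) m[of Q] by (cases "Q \<in> F") (simp_all add: F'_def sum.remove)
    ultimately show ?case by simp
  qed
  have "\<exists>n. F \<subseteq> (\<Union>k<n. generation B k Q)"
    using F
  proof (induction F)
    case (insert S F)
    then obtain n k where "F \<subseteq> (\<Union>k<n. generation B k Q)" "S \<in> generation B k Q"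
      by (auto simp: all_generations_def)
    then have "insert S F \<subseteq> (\<Union>j<max n (Suc k). generation B j Q)" by fastforce
    then show ?case ..
  qed auto
  then show ?thesis using bound[OF Q F(1)] by blast
qed

section \<open>The potential of a matrix weight\<close>

text \<open>Collects what the potential argument asks of a single set in any measure space; the
  geometry of cubes enters separately, through nesting.\<close>

definition weight_on :: "'a measure \<Rightarrow> ('a \<Rightarrow> real ^ 'N ^ 'N) \<Rightarrow> 'a set \<Rightarrow> bool" where
  "weight_on \<mu> W Q \<longleftrightarrow> Q \<in> sets \<mu> \<and> emeasure \<mu> Q < \<infinity> \<and> (AE x in \<mu>. pos_def (W x)) \<and>
     set_integrable \<mu> Q W \<and> set_integrable \<mu> Q (\<lambda>x. W x ** W x) \<and>
     set_integrable \<mu> Q (\<lambda>x. ln (det (W x ** W x)))"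

text \<open>A factor strictly between 0 and 1 on the squared mean keeps the matrix positive definite
  and still leaves a multiple of the variance.\<close>

definition potential_matrix :: "'a measure \<Rightarrow> ('a \<Rightarrow> real ^ 'N ^ 'N) \<Rightarrow> 'a set \<Rightarrow> real ^ 'N ^ 'N" where
  "potential_matrix \<mu> W Q =
     average \<mu> Q (\<lambda>x. W x ** W x) - (1 / 2) *\<^sub>R (average \<mu> Q W ** average \<mu> Q W)"

text \<open>For a constant weight \<open>potential_matrix\<close> is half of the squared weight;
  subtracting \<open>ln 2\<close> once per dimension makes the potential vanish in that
  case.\<close>

definition potential :: "'a measure \<Rightarrow> ('a \<Rightarrow> real ^ 'N ^ 'N) \<Rightarrow> 'a set \<Rightarrow> real" where
  "potential \<mu> W Q = measure \<mu> Q * ln (det (potential_matrix \<mu> W Q))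
     - (LINT x:Q|\<mu>. ln (det (W x ** W x)) - real CARD('N) * ln 2)"

context
  fixes \<mu> :: "'a measure" and W :: "'a \<Rightarrow> real ^ 'N ^ 'N" and Q :: "'a set"
  assumes w: "weight_on \<mu> W Q" and pos: "0 < measure \<mu> Q"
begin

lemma average_weight_pos_def: "pos_def (average \<mu> Q W)"
proof -
  have int: "set_integrable \<mu> Q W" and pd: "AE x in \<mu>. pos_def (W x)" and Q: "Q \<in> sets \<mu>"
    using w by (auto simp: weight_on_def)
  have "0 < v \<bullet> (average \<mu> Q W *v v)" if "v \<noteq> 0" for v
    unfolding average_bounded_linear[OF bounded_linear_bilinear_form int]
    by (rule average_pos[OF set_integrable_bounded_linear[OF bounded_linear_bilinear_form int] Q pos])
      (use pd that in \<open>auto simp: pos_def_def elim: eventually_mono\<close>)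
  moreover have "transpose (average \<mu> Q W) = average \<mu> Q W"
    by (rule average_transpose[OF int]) (use pd in \<open>auto simp: pos_def_def elim: eventually_mono\<close>)
  ultimately show ?thesis by (simp add: pos_def_def)
qed

lemma average_square_symmetric:
  "transpose (average \<mu> Q (\<lambda>x. W x ** W x)) = average \<mu> Q (\<lambda>x. W x ** W x)"
  using w by (intro average_transpose)
    (auto simp: weight_on_def pos_def_def transpose_square elim: eventually_mono)

text \<open>The variance of \<open>W x *v v\<close> over \<open>Q\<close> is nonnegative.\<close>

lemma square_average_le:
  "(norm (average \<mu> Q W *v v))\<^sup>2 \<le> v \<bullet> (average \<mu> Q (\<lambda>x. W x ** W x) *v v)"
proof -
  define X where "X = average \<mu> Q W"
  have int: "set_integrable \<mu> Q W" "set_integrable \<mu> Q (\<lambda>x. W x ** W x)"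
    and pd: "AE x in \<mu>. pos_def (W x)" and Q: "Q \<in> sets \<mu>" "emeasure \<mu> Q < \<infinity>"
    using w by (auto simp: weight_on_def)
  have T: "bounded_linear (\<lambda>M. - 2 * ((X *v v) \<bullet> (M *v v)))"
    by (rule bounded_linear_const_mult[OF bounded_linear_bilinear_form])
  \<comment> \<open>The integrand is the squared norm of \<open>W x *v v - X *v v\<close>, expanded
    to fit \<open>average_affine\<close>.\<close>
  have "0 \<le> average \<mu> Q (\<lambda>x. (norm (X *v v))\<^sup>2 + v \<bullet> ((W x ** W x) *v v) + - 2 * ((X *v v) \<bullet> (W x *v v)))"
  proof (rule average_nonneg, use pd in eventually_elim)
    case (elim x)
    have "(norm (X *v v))\<^sup>2 + v \<bullet> ((W x ** W x) *v v) + - 2 * ((X *v v) \<bullet> (W x *v v))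
      = (norm (W x *v v - X *v v))\<^sup>2"
      using elim
      by (simp add: pos_def_def quadratic_form_square)
        (simp add: power2_norm_eq_inner inner_diff_left inner_diff_right inner_commute)
    then show ?case by simp
  qed
  also have "\<dots> = (norm (X *v v))\<^sup>2 + v \<bullet> (average \<mu> Q (\<lambda>x. W x ** W x) *v v)
      + - 2 * ((X *v v) \<bullet> (average \<mu> Q W *v v))"
    by (rule average_affine[OF Q pos bounded_linear_bilinear_form int(2) T int(1)])
  finally show ?thesis
    by (simp add: X_def power2_norm_eq_inner)
qed

lemma average_square_pos_def: "pos_def (average \<mu> Q (\<lambda>x. W x ** W x))"
proof -
  have "0 < v \<bullet> (average \<mu> Q (\<lambda>x. W x ** W x) *v v)" if "v \<noteq> 0" for v
  proof -
    have "average \<mu> Q W *v v \<noteq> 0"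
      using pos_def_mult_nonzero[OF average_weight_pos_def that] .
    then have "0 < (norm (average \<mu> Q W *v v))\<^sup>2" by simp
    then show ?thesis using square_average_le[of v] by linarith
  qed
  then show ?thesis by (simp add: pos_def_def average_square_symmetric)
qed

lemma potential_matrix_form:
  "v \<bullet> (potential_matrix \<mu> W Q *v v) =
     v \<bullet> (average \<mu> Q (\<lambda>x. W x ** W x) *v v) - (norm (average \<mu> Q W *v v))\<^sup>2 / 2"
  using average_weight_pos_def
  by (simp add: potential_matrix_def matrix_vector_mult_diff_rdistrib inner_diff_right
      quadratic_form_square pos_def_def flip: scaleR_matrix_vector_assoc)

lemma potential_matrix_pos_def: "pos_def (potential_matrix \<mu> W Q)"
proof -
  have X: "pos_def (average \<mu> Q W)" by (rule average_weight_pos_def)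
  have "0 < v \<bullet> (potential_matrix \<mu> W Q *v v)" if "v \<noteq> 0" for v
  proof -
    have "average \<mu> Q W *v v \<noteq> 0"
      using pos_def_mult_nonzero[OF X that] .
    then have "0 < (norm (average \<mu> Q W *v v))\<^sup>2" by simp
    then show ?thesis unfolding potential_matrix_form using square_average_le[of v] by linarith
  qed
  moreover have "transpose (potential_matrix \<mu> W Q) = potential_matrix \<mu> W Q"
    using X unfolding potential_matrix_def transpose_diff transpose_scalar average_square_symmetric
    by (simp add: transpose_square pos_def_def)
  ultimately show ?thesis by (simp add: pos_def_def)
qed

section \<open>Jensen's inequality and bounds from the determinant condition\<close>

text \<open>Jensen's inequality for the concave \<open>ln det\<close>: the tangent at
  \<open>X\<close> is integrated, and its trace term averages to the dimension. The factor 2 comes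
  from squaring \<open>W x\<close>.\<close>

lemma average_ln_det_square_le:
  "average \<mu> Q (\<lambda>x. ln (det (W x ** W x))) \<le> 2 * ln (det (average \<mu> Q W))"
proof -
  define X where "X = average \<mu> Q W"
  define L where "L = 2 * (ln (det X) - real CARD('N))"
  have int: "set_integrable \<mu> Q W" "set_integrable \<mu> Q (\<lambda>x. ln (det (W x ** W x)))"
    and pd: "AE x in \<mu>. pos_def (W x)" and Q: "Q \<in> sets \<mu>" "emeasure \<mu> Q < \<infinity>"
    using w by (auto simp: weight_on_def)
  have X: "pos_def X" unfolding X_def by (rule average_weight_pos_def)
  \<comment> \<open>The zero functional fills a slot of \<open>average_affine\<close>, as the
    tangent involves \<open>W x\<close> alone.\<close>
  have S: "bounded_linear (\<lambda>M :: real ^ 'N ^ 'N. 0 :: real)" by simp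
  have T: "bounded_linear (\<lambda>M. 2 * trace (matrix_inv X ** M))"
    by (rule bounded_linear_const_mult[OF bounded_linear_trace_mult])
  have "average \<mu> Q (\<lambda>x. ln (det (W x ** W x)))
      \<le> average \<mu> Q (\<lambda>x. L + 0 + 2 * trace (matrix_inv X ** W x))"
  proof (rule average_mono[OF int(2) set_integrable_affine[OF Q S int(1) T int(1)]], use pd in eventually_elim)
    case (elim x)
    then show ?case
      using ln_det_tangent[OF X elim] pos_def_det_pos[OF elim] by (simp add: L_def det_mul ln_mult_pos)
  qed
  also have "\<dots> = L + 0 + 2 * trace (matrix_inv X ** X)"
    unfolding X_def by (rule average_affine[OF Q pos S int(1) T[unfolded X_def] int(1)])
  also have "matrix_inv X ** X = mat 1"
    by (rule matrix_inv_left[OF pos_def_invertible[OF X]])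
  finally show ?thesis by (simp add: L_def X_def trace_I)
qed

text \<open>Jensen turns the assumption into a bound of \<open>det Y\<close> by
  \<open>C\<^sup>2 * det (X ** X)\<close>; as \<open>X ** X\<close> lies below \<open>Y\<close>,
  comparing determinants suffices to compare forms.\<close>

lemma average_square_le:
  assumes "det (average \<mu> Q (\<lambda>x. W x ** W x)) \<le> C\<^sup>2 * exp (average \<mu> Q (\<lambda>x. ln (det (W x ** W x))))"
  shows "v \<bullet> (average \<mu> Q (\<lambda>x. W x ** W x) *v v) \<le> C\<^sup>2 * (norm (average \<mu> Q W *v v))\<^sup>2"
proof -
  define X where "X = average \<mu> Q W"
  have X: "pos_def X" unfolding X_def by (rule average_weight_pos_def)
  have sX: "transpose X = X" using X by (simp add: pos_def_def)
  have "exp (average \<mu> Q (\<lambda>x. ln (det (W x ** W x)))) \<le> exp (2 * ln (det X))"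
    unfolding X_def using average_ln_det_square_le by simp
  also have "\<dots> = det (X ** X)"
    using pos_def_det_pos[OF X] by (simp add: det_mul exp_double power2_eq_square)
  finally have "det (average \<mu> Q (\<lambda>x. W x ** W x)) \<le> C\<^sup>2 * det (X ** X)"
    using assms by (meson mult_left_mono order_trans zero_le_power2)
  from quadratic_form_le_det_quotient[OF pos_def_square[OF X] average_square_symmetric _ this]
  show ?thesis
    using square_average_le unfolding X_def[symmetric] quadratic_form_square[OF sX] by blast
qed

text \<open>\<open>det Z \<le> det Y\<close>, and the assumption bounds \<open>ln (det Y)\<close> by
  \<open>ln (C\<^sup>2)\<close> plus the mean of \<open>ln det\<close> that the potential
  subtracts.\<close>

lemma potential_le:
  assumes "det (average \<mu> Q (\<lambda>x. W x ** W x)) \<le> C\<^sup>2 * exp (average \<mu> Q (\<lambda>x. ln (det (W x ** W x))))"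
  shows "potential \<mu> W Q \<le> measure \<mu> Q * (ln (C\<^sup>2) + real CARD('N) * ln 2)"
proof -
  define X where "X = average \<mu> Q W"
  define Y where "Y = average \<mu> Q (\<lambda>x. W x ** W x)"
  define Z where "Z = potential_matrix \<mu> W Q"
  define l where "l = average \<mu> Q (\<lambda>x. ln (det (W x ** W x)))"
  have X: "pos_def X" and Y: "pos_def Y" and Z: "pos_def Z"
    unfolding X_def Y_def Z_def
    by (rule average_weight_pos_def average_square_pos_def potential_matrix_pos_def)+
  have int: "set_integrable \<mu> Q (\<lambda>x. ln (det (W x ** W x)))"
    and pd: "AE x in \<mu>. pos_def (W x)" and Q: "Q \<in> sets \<mu>" "emeasure \<mu> Q < \<infinity>"
    using w by (auto simp: weight_on_def)
  \<comment> \<open>In the tangent at \<open>Y\<close>, the subtracted half square can only push the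
    trace below the dimension.\<close>
  have "trace (matrix_inv Y ** Z) = trace (matrix_inv Y ** Y) - trace (matrix_inv Y ** (X ** X)) / 2"
    by (simp add: Z_def potential_matrix_def X_def Y_def matrix_mul_diff_right trace_sub
        matrix_mul_scaleR_right trace_scaleR)
  moreover have "matrix_inv Y ** Y = mat 1"
    by (rule matrix_inv_left[OF pos_def_invertible[OF Y]])
  moreover have "0 \<le> trace (matrix_inv Y ** (X ** X))"
    using X by (intro trace_inv_square_nonneg[OF Y]) (simp add: pos_def_def)
  ultimately have ZY: "ln (det Z) \<le> ln (det Y)"
    using ln_det_tangent[OF Y Z] by (simp add: trace_I)
  have "C \<noteq> 0" using assms pos_def_det_pos[OF Y] unfolding Y_def by auto
  then have C: "0 < C\<^sup>2" by simp
  have "ln (det Y) \<le> ln (C\<^sup>2 * exp l)"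
    using assms pos_def_det_pos[OF Y] by (simp add: Y_def l_def)
  also have "\<dots> = ln (C\<^sup>2) + l"
    using C by (subst ln_mult_pos) auto
  finally have ZC: "ln (det Z) \<le> ln (C\<^sup>2) + l" using ZY by simp
  have "(LINT x:Q|\<mu>. ln (det (W x ** W x)) - real CARD('N) * ln 2)
      = (LINT x:Q|\<mu>. ln (det (W x ** W x))) - (LINT x:Q|\<mu>. real CARD('N) * ln 2)"
    using int by (intro set_integral_diff set_integrable_const Q)
  also have "(LINT x:Q|\<mu>. real CARD('N) * ln 2) = measure \<mu> Q * (real CARD('N) * ln 2)"
    using Q by (simp add: set_lebesgue_integral_def)
  also have "(LINT x:Q|\<mu>. ln (det (W x ** W x))) - measure \<mu> Q * (real CARD('N) * ln 2)
      = measure \<mu> Q * (l - real CARD('N) * ln 2)"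
    using pos by (simp add: l_def average_def algebra_simps)
  finally show ?thesis
    using mult_left_mono[OF ZC, of "measure \<mu> Q"]
    by (simp add: potential_def Z_def algebra_simps)
qed

end

section \<open>Descent of the potential under stopping\<close>

text \<open>One nonnegative integrand serves \<open>Q\<close> and every \<open>R\<close> at once,
  with equality on \<open>Q\<close>. Summing over disjoint stopping cubes then reduces to
  monotonicity of the integral.\<close>

lemma potential_density:
  fixes \<mu> :: "'a measure" and W :: "'a \<Rightarrow> real ^ 'N ^ 'N"
  assumes wQ: "weight_on \<mu> W Q" and posQ: "0 < measure \<mu> Q"
  obtains k where "set_integrable \<mu> Q k" "AE x in \<mu>. 0 \<le> k x"
    "(LINT x:Q|\<mu>. k x) = potential \<mu> W Q"
    "\<And>R. weight_on \<mu> W R \<Longrightarrow>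
      potential \<mu> W R + measure \<mu> R / 2 *
        trace (matrix_inv (potential_matrix \<mu> W Q) **
          ((average \<mu> R W - average \<mu> Q W) ** (average \<mu> R W - average \<mu> Q W)))
      \<le> (LINT x:R|\<mu>. k x)"
proof -
  define X where "X = average \<mu> Q W"
  define Z where "Z = potential_matrix \<mu> W Q"
  define T where "T M = trace (matrix_inv Z ** M)" for M :: "real ^ 'N ^ 'N"
  \<comment> \<open>\<open>2 * U M\<close> is the cross term of
    \<open>T ((M - X) ** (M - X))\<close>. As \<open>M\<close> and \<open>X\<close> need not commute
    there are two traces, one of them cycled so that \<open>M\<close> stands last.\<close>
  define U :: "real ^ 'N ^ 'N \<Rightarrow> real" where
    "U M = - (1 / 2) * trace ((X ** matrix_inv Z) ** M) + - (1 / 2) * trace ((matrix_inv Z ** X) ** M)" for M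
  define a where "a = ln (det Z) - real CARD('N) + T (X ** X) / 2"
  define p where "p = (\<lambda>x. ln (det (W x ** W x)) - real CARD('N) * ln 2)"
  \<comment> \<open>By \<open>TU\<close>, this is the tangent at \<open>Z\<close>, evaluated at half
    of \<open>W x ** W x\<close>, plus half of \<open>T\<close> at the squared deviation of
    \<open>W x\<close> from \<open>X\<close>. Being affine in \<open>W x ** W x\<close> and
    \<open>W x\<close>, it can be averaged over any \<open>R\<close>.\<close>
  define h where "h x = a + T (W x ** W x) + U (W x)" for x
  have X: "pos_def X" and Z: "pos_def Z"
    unfolding X_def Z_def by (rule average_weight_pos_def[OF wQ posQ] potential_matrix_pos_def[OF wQ posQ])+
  have T: "bounded_linear T"
    unfolding T_def by (rule bounded_linear_trace_mult)
  have U: "bounded_linear U"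
    unfolding U_def by (intro bounded_linear_const_mult bounded_linear_add bounded_linear_trace_mult)
  have TU: "T ((M - X) ** (M - X)) = T (M ** M) + T (X ** X) + 2 * U M" for M
  proof -
    have "trace ((X ** matrix_inv Z) ** M) = trace (matrix_inv Z ** (M ** X))"
      using trace_mul_sym[of X "matrix_inv Z ** M"] by (simp add: matrix_mul_assoc)
    then have "2 * U M = - T (M ** X) - T (X ** M)"
      by (simp add: T_def U_def matrix_mul_assoc)
    then show ?thesis
      by (simp add: T_def matrix_mul_diff_left matrix_mul_diff_right trace_sub matrix_mul_assoc)
  qed
  have Thalf: "T ((1 / 2) *\<^sub>R M) = T M / 2" for M
    by (simp add: T_def matrix_mul_scaleR_right trace_scaleR)
  have pd: "AE x in \<mu>. pos_def (W x)" using wQ by (simp add: weight_on_def)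
  have p_le: "AE x in \<mu>. 0 \<le> h x - p x"
    using pd
  proof eventually_elim
    case (elim x)
    have sq: "pos_def (W x ** W x)" by (rule pos_def_square[OF elim])
    have "transpose (W x - X) = W x - X"
      using elim X by (simp add: pos_def_def transpose_diff)
    then have "0 \<le> T ((W x - X) ** (W x - X))"
      unfolding T_def by (rule trace_inv_square_nonneg[OF Z])
    moreover have "p x \<le> ln (det Z) + T (W x ** W x) / 2 - real CARD('N)"
      using ln_det_tangent[OF Z pos_def_scaleR[OF sq, of "1 / 2"]] ln_det_half[OF pos_def_det_pos[OF sq]]
      by (simp add: p_def Thalf flip: T_def)
    ultimately show ?case unfolding h_def a_def TU by (simp add: field_simps)
  qed
  have int_h: "set_integrable \<mu> R h" if "weight_on \<mu> W R" for R
    unfolding h_def using that by (intro set_integrable_affine T U) (auto simp: weight_on_def)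
  have int_p: "set_integrable \<mu> R p" if "weight_on \<mu> W R" for R
    unfolding p_def using that by (intro set_integral_diff set_integrable_const) (auto simp: weight_on_def)
  \<comment> \<open>Using \<open>TU\<close> at the average of \<open>W\<close> regroups the same
    affine expression: half of the squared mean goes into \<open>potential_matrix\<close>, the rest
    is the deviation between the means.\<close>
  have avg_h: "(LINT x:R|\<mu>. h x) = measure \<mu> R * (ln (det Z) - real CARD('N)
      + T (potential_matrix \<mu> W R) + T ((average \<mu> R W - X) ** (average \<mu> R W - X)) / 2)"
    if R: "weight_on \<mu> W R" "0 < measure \<mu> R" for R
  proof -
    have "average \<mu> R h = a + T (average \<mu> R (\<lambda>x. W x ** W x)) + U (average \<mu> R W)"
      unfolding h_def using R by (intro average_affine T U) (auto simp: weight_on_def)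
    also have "\<dots> = ln (det Z) - real CARD('N)
      + T (potential_matrix \<mu> W R) + T ((average \<mu> R W - X) ** (average \<mu> R W - X)) / 2"
      unfolding TU potential_matrix_def a_def linear_simps(2)[OF T] Thalf by (simp add: field_simps)
    finally show ?thesis
      using R(2) by (simp add: average_def field_simps)
  qed
  have diff: "(LINT x:R|\<mu>. h x - p x) = (LINT x:R|\<mu>. h x) - (LINT x:R|\<mu>. p x)" if "weight_on \<mu> W R" for R
    using int_h[OF that] int_p[OF that] by (rule set_integral_diff)
  show ?thesis
  proof (rule that[of "\<lambda>x. h x - p x"])
    show "set_integrable \<mu> Q (\<lambda>x. h x - p x)"
      using int_h[OF wQ] int_p[OF wQ] by (rule set_integral_diff)
    show "AE x in \<mu>. 0 \<le> h x - p x" by (rule p_le)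
    \<comment> \<open>On \<open>Q\<close> itself the tangent touches and the deviation of the mean
      vanishes, whence equality.\<close>
    have "matrix_inv Z ** Z = mat 1"
      by (rule matrix_inv_left[OF pos_def_invertible[OF Z]])
    then have "T Z = real CARD('N)" by (simp add: T_def trace_I)
    moreover have "T ((X - X) ** (X - X)) = 0" by (simp add: linear_simps(3)[OF T])
    ultimately have "(LINT x:Q|\<mu>. h x) = measure \<mu> Q * ln (det Z)"
      using avg_h[OF wQ posQ] unfolding X_def[symmetric] Z_def[symmetric] by simp
    then show "(LINT x:Q|\<mu>. h x - p x) = potential \<mu> W Q"
      unfolding diff[OF wQ] by (simp add: potential_def Z_def p_def)
  next
    fix R assume R: "weight_on \<mu> W R"
    have "potential \<mu> W R + measure \<mu> R / 2 * T ((average \<mu> R W - X) ** (average \<mu> R W - X))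
      \<le> (LINT x:R|\<mu>. h x - p x)"
    proof (cases "measure \<mu> R = 0")
      case True
      then show ?thesis
        using R by (simp add: potential_def set_integral_measure_zero weight_on_def)
    next
      case False
      then have posR: "0 < measure \<mu> R" by (simp add: zero_less_measure_iff)
      have "ln (det (potential_matrix \<mu> W R)) \<le> ln (det Z) + T (potential_matrix \<mu> W R) - real CARD('N)"
        unfolding T_def by (rule ln_det_tangent[OF Z potential_matrix_pos_def[OF R posR]])
      from mult_left_mono[OF this, of "measure \<mu> R"] show ?thesis
        unfolding diff[OF R] avg_h[OF R posR] by (simp add: potential_def p_def algebra_simps)
    qed
    then show "potential \<mu> W R + measure \<mu> R / 2 *
        trace (matrix_inv (potential_matrix \<mu> W Q) **
          ((average \<mu> R W - average \<mu> Q W) ** (average \<mu> R W - average \<mu> Q W)))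
      \<le> (LINT x:R|\<mu>. h x - p x)"
      by (simp add: T_def X_def Z_def)
  qed
qed

lemma potential_measure_zero:
  "weight_on \<mu> W Q \<Longrightarrow> measure \<mu> Q = 0 \<Longrightarrow> potential \<mu> W Q = 0"
  by (simp add: potential_def set_integral_measure_zero weight_on_def)

text \<open>Each stopping cube has deviation trace at least
  \<open>\<epsilon>\<^sup>2 / C\<^sup>2\<close>; the factor one half in
  \<open>potential_density\<close> accounts for the 2 in the denominator.\<close>

lemma sum_potential_le:
  fixes \<mu> :: "'a measure" and W :: "'a \<Rightarrow> real ^ 'N ^ 'N"
  assumes wQ: "weight_on \<mu> W Q"
    and det: "det (average \<mu> Q (\<lambda>x. W x ** W x)) \<le> C\<^sup>2 * exp (average \<mu> Q (\<lambda>x. ln (det (W x ** W x))))"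
    and F: "finite F" "disjoint F" "\<And>R. R \<in> F \<Longrightarrow> weight_on \<mu> W R \<and> R \<subseteq> Q"
    and stop: "\<And>R. R \<in> F \<Longrightarrow>
      \<epsilon> < onorm ((*v) (matrix_inv (average \<mu> Q W) ** average \<mu> R W - mat 1))"
    and \<epsilon>: "0 < \<epsilon>" and C: "C \<noteq> 0"
  shows "(\<Sum>R\<in>F. potential \<mu> W R + \<epsilon>\<^sup>2 / (2 * C\<^sup>2) * measure \<mu> R) \<le> potential \<mu> W Q"
proof (cases "measure \<mu> Q = 0")
  case True
  have "measure \<mu> R = 0" if "R \<in> F" for R
    using measure_mono_fmeasurable[of R Q \<mu>] F(3)[OF that] wQ True
    by (simp add: weight_on_def fmeasurable_def measure_le_0_iff)
  then show ?thesis
    using F(3) potential_measure_zero[OF wQ True] by (simp add: potential_measure_zero)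
next
  case False
  then have posQ: "0 < measure \<mu> Q" by (simp add: zero_less_measure_iff)
  define X where "X = average \<mu> Q W"
  define Z where "Z = potential_matrix \<mu> W Q"
  have X: "pos_def X" and Z: "pos_def Z"
    unfolding X_def Z_def by (rule average_weight_pos_def[OF wQ posQ] potential_matrix_pos_def[OF wQ posQ])+
  obtain k where k: "set_integrable \<mu> Q k" "AE x in \<mu>. 0 \<le> k x"
    "(LINT x:Q|\<mu>. k x) = potential \<mu> W Q"
    and kR: "\<And>R. weight_on \<mu> W R \<Longrightarrow>
      potential \<mu> W R + measure \<mu> R / 2 *
        trace (matrix_inv Z ** ((average \<mu> R W - X) ** (average \<mu> R W - X))) \<le> (LINT x:R|\<mu>. k x)"
    unfolding X_def Z_def using potential_density[OF wQ posQ] by blast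
  \<comment> \<open>Dropping the subtracted square leaves the form of the averaged square of
    \<open>W\<close>.\<close>
  have le: "v \<bullet> (Z *v v) \<le> C\<^sup>2 * (norm (X *v v))\<^sup>2" for v
    using average_square_le[OF wQ posQ det, of v]
    unfolding Z_def X_def potential_matrix_form[OF wQ posQ]
    by (smt (verit) divide_nonneg_nonneg zero_le_power2)
  have "potential \<mu> W R + \<epsilon>\<^sup>2 / (2 * C\<^sup>2) * measure \<mu> R \<le> (LINT x:R|\<mu>. k x)" if R: "R \<in> F" for R
  proof (cases "measure \<mu> R = 0")
    case True
    then show ?thesis using kR[of R] F(3)[OF R] by simp
  next
    case False
    then have posR: "0 < measure \<mu> R" by (simp add: zero_less_measure_iff)
    have wR: "weight_on \<mu> W R" using F(3)[OF R] by simp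
    define D where "D = average \<mu> R W - X"
    have "transpose D = D"
      using X average_weight_pos_def[OF wR posR] by (simp add: D_def transpose_diff pos_def_def)
    from trace_inv_square_ge_onorm[OF X Z this le]
    have "(onorm ((*v) (matrix_inv X ** D)))\<^sup>2 \<le> C\<^sup>2 * trace (matrix_inv Z ** (D ** D))" by simp
    moreover have "matrix_inv X ** D = matrix_inv X ** average \<mu> R W - mat 1"
    proof -
      have "matrix_inv X ** X = mat 1"
        by (rule matrix_inv_left[OF pos_def_invertible[OF X]])
      then show ?thesis by (simp add: D_def matrix_mul_diff_right)
    qed
    moreover have "\<epsilon>\<^sup>2 \<le> (onorm ((*v) (matrix_inv X ** average \<mu> R W - mat 1)))\<^sup>2"
      using stop[OF R] \<epsilon> unfolding X_def by (intro power_mono) auto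
    ultimately have "\<epsilon>\<^sup>2 \<le> C\<^sup>2 * trace (matrix_inv Z ** (D ** D))" by simp
    then have "\<epsilon>\<^sup>2 / C\<^sup>2 \<le> trace (matrix_inv Z ** (D ** D))"
      using C by (simp add: divide_le_eq mult.commute)
    from mult_left_mono[OF this, of "measure \<mu> R / 2"]
    have "\<epsilon>\<^sup>2 / (2 * C\<^sup>2) * measure \<mu> R \<le> measure \<mu> R / 2 * trace (matrix_inv Z ** (D ** D))"
      by (simp add: mult_ac)
    with kR[OF wR] show ?thesis by (simp add: D_def)
  qed
  then have "(\<Sum>R\<in>F. potential \<mu> W R + \<epsilon>\<^sup>2 / (2 * C\<^sup>2) * measure \<mu> R) \<le> (\<Sum>R\<in>F. LINT x:R|\<mu>. k x)"
    by (rule sum_mono)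
  also have "\<dots> \<le> (LINT x:Q|\<mu>. k x)"
    using F wQ k(1,2) by (intro sum_set_integral_le) (auto simp: weight_on_def elim: eventually_mono)
  finally show ?thesis by (simp add: k(3))
qed

section \<open>The packing condition\<close>

text \<open>\<open>Q\<close> is among its own stopping cubes, so unless the measure vanishes no
  single \<open>C\<close> serves arbitrarily large \<open>\<epsilon>3\<close>;
  \<open>\<epsilon>0\<close> caps the range where \<open>C\<close> is uniform. For a fixed
  \<open>\<epsilon>3\<close> one takes \<open>\<epsilon>0 = \<epsilon>3\<close>.\<close>

theorem proposition4p4:
  fixes m :: "real ^ 'n \<Rightarrow> real"
    and \<mu> :: "(real ^ 'n) measure"
    and W :: "real ^ 'n \<Rightarrow> real ^ 'N ^ 'N"
    and C2 \<epsilon>0 :: real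
  assumes "m \<in> borel_measurable lebesgue" and "\<And>x. 0 \<le> m x"
    and "\<mu> = density lebesgue (\<lambda>x. ennreal (m x))"
    and "doubling \<mu>"
    and "matrix_weight \<mu> W"
    and "det_reverse_Jensen \<mu> W C2"
  shows "\<exists>C. \<forall>\<epsilon>3. 0 < \<epsilon>3 \<and> \<epsilon>3 \<le> \<epsilon>0 \<longrightarrow>
           (\<forall>Q\<in>dyadic_cubes.
              (\<Sum>\<^sub>\<infinity>R\<in>all_generations (weight_stopping \<mu> W \<epsilon>3) Q. emeasure \<mu> R)
                \<le> ennreal (C / \<epsilon>3\<^sup>2) * emeasure \<mu> Q)"
proof -
  have weight: "weight_on \<mu> W Q" if D: "Q \<in> dyadic_cubes" for Q
  proof -
    obtain c l where Q: "0 < l" "Q = cube c l" using dyadic_cube_is_cube[OF D] .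
    have "Q \<in> sets \<mu>"
      unfolding Q(2) assms(3) sets_density using cube_borel[of c l] by simp
    moreover have "emeasure \<mu> Q < \<infinity>"
      using assms(4) Q by (simp add: doubling_def)
    ultimately show ?thesis
      using assms(5,6) Q unfolding weight_on_def matrix_weight_def det_reverse_Jensen_def by blast
  qed
  have det: "det (average \<mu> Q (\<lambda>x. W x ** W x)) \<le> C2\<^sup>2 * exp (average \<mu> Q (\<lambda>x. ln (det (W x ** W x))))"
    if D: "Q \<in> dyadic_cubes" for Q
  proof -
    obtain c l where Q: "0 < l" "Q = cube c l" using dyadic_cube_is_cube[OF D] .
    show ?thesis
      unfolding Q(2) using assms(6) Q(1) by (simp add: det_reverse_Jensen_def)
  qed
  have em: "emeasure \<mu> Q = ennreal (measure \<mu> Q)" if "Q \<in> dyadic_cubes" for Q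
    using weight[OF that] by (simp add: weight_on_def emeasure_eq_ennreal_measure less_top)
  \<comment> \<open>Division by \<open>C2\<close> is legitimate once some dyadic cube has positive
    measure.\<close>
  have C2: "C2 \<noteq> 0" if "Q \<in> dyadic_cubes" "0 < measure \<mu> Q" for Q
    using det[OF that(1)] pos_def_det_pos[OF average_square_pos_def[OF weight[OF that(1)] that(2)]]
    by auto
  define K where "K = ln (C2\<^sup>2) + real CARD('N) * ln 2"
  \<comment> \<open>The first summand pays for \<open>Q\<close> itself, through
    \<open>\<epsilon> \<le> \<epsilon>0\<close>; the second is the bound \<open>K\<close> on the
    potential per unit of measure, after division by \<open>c\<close>.\<close>
  define C where "C = \<epsilon>0\<^sup>2 + 2 * C2\<^sup>2 * \<bar>K\<bar>"
  have bound: "(\<Sum>R\<in>F. measure \<mu> R) \<le> C / \<epsilon>\<^sup>2 * measure \<mu> Q"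
    if \<epsilon>: "0 < \<epsilon>" "\<epsilon> \<le> \<epsilon>0" and Q: "Q \<in> dyadic_cubes" "0 < measure \<mu> Q"
      and F: "finite F" "F \<subseteq> all_generations (weight_stopping \<mu> W \<epsilon>) Q" for \<epsilon> Q F
  proof -
    define c where "c = \<epsilon>\<^sup>2 / (2 * C2\<^sup>2)"
    have c: "0 < c" using C2[OF Q] \<epsilon> by (simp add: c_def)
    have "(\<Sum>R\<in>F. c * measure \<mu> R) \<le> potential \<mu> W Q + c * measure \<mu> Q"
    proof (rule sum_generations_le[where D = dyadic_cubes and B = "weight_stopping \<mu> W \<epsilon>"])
      fix Q' :: "(real ^ 'n) set" and F'
      assume Q': "Q' \<in> dyadic_cubes" "finite F'" "F' \<subseteq> weight_stopping \<mu> W \<epsilon> Q'"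
      have "disjoint F'"
        using pairwise_subset[OF maximal_subcubes_disjoint Q'(3)[unfolded weight_stopping_def]] .
      with Q' show "(\<Sum>R\<in>F'. potential \<mu> W R + c * measure \<mu> R) \<le> potential \<mu> W Q'"
        unfolding c_def using weight \<epsilon> C2[OF Q]
        by (intro sum_potential_le det) (auto simp: weight_stopping_def maximal_subcubes_def)
    qed (use Q F c in \<open>auto simp: weight_stopping_def maximal_subcubes_def\<close>)
    also have "potential \<mu> W Q \<le> measure \<mu> Q * K"
      unfolding K_def by (rule potential_le[OF weight[OF Q(1)] Q(2) det[OF Q(1)]])
    also have "measure \<mu> Q * K + c * measure \<mu> Q \<le> c * (C / \<epsilon>\<^sup>2 * measure \<mu> Q)"
    proof -
      have "\<epsilon>\<^sup>2 \<le> \<epsilon>0\<^sup>2" using \<epsilon> by (intro power_mono) auto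
      then have "c * 1 \<le> c * (\<epsilon>0\<^sup>2 / \<epsilon>\<^sup>2)"
        using c \<epsilon> by (intro mult_left_mono) auto
      moreover have "K \<le> c * (2 * C2\<^sup>2 * \<bar>K\<bar> / \<epsilon>\<^sup>2)"
        using C2[OF Q] \<epsilon> by (simp add: c_def)
      ultimately have "K + c \<le> c * (C / \<epsilon>\<^sup>2)"
        by (simp add: C_def add_divide_distrib distrib_left)
      from mult_right_mono[OF this, of "measure \<mu> Q"] show ?thesis
        by (simp add: algebra_simps)
    qed
    finally have "c * (\<Sum>R\<in>F. measure \<mu> R) \<le> c * (C / \<epsilon>\<^sup>2 * measure \<mu> Q)"
      by (simp only: sum_distrib_left)
    then show ?thesis using c by (rule mult_left_le_imp_le)
  qed
  have sub: "R \<in> dyadic_cubes \<and> R \<subseteq> Q"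
    if "R \<in> generation (weight_stopping \<mu> W \<epsilon>) k Q" "Q \<in> dyadic_cubes" for \<epsilon> k Q R
    using that
    by (induction k arbitrary: R) (fastforce simp: weight_stopping_def maximal_subcubes_def)+
  show ?thesis
  proof (intro exI[of _ C] allI impI ballI)
    fix \<epsilon> and Q :: "(real ^ 'n) set"
    assume \<epsilon>: "0 < \<epsilon> \<and> \<epsilon> \<le> \<epsilon>0" and Q: "Q \<in> dyadic_cubes"
    have "sum (emeasure \<mu>) F \<le> ennreal (C / \<epsilon>\<^sup>2) * emeasure \<mu> Q"
      if F: "finite F" "F \<subseteq> all_generations (weight_stopping \<mu> W \<epsilon>) Q" for F
    proof -
      have FQ: "R \<in> dyadic_cubes" "R \<subseteq> Q" if "R \<in> F" for R
        using F(2) that sub[OF _ Q] unfolding all_generations_def by blast+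
      have "(\<Sum>R\<in>F. measure \<mu> R) \<le> C / \<epsilon>\<^sup>2 * measure \<mu> Q"
      proof (cases "measure \<mu> Q = 0")
        case True
        have "measure \<mu> R = 0" if "R \<in> F" for R
          using measure_mono_fmeasurable[of R Q \<mu>] FQ[OF that] weight[OF Q] weight[OF FQ(1)[OF that]] True
          by (simp add: weight_on_def fmeasurable_def measure_le_0_iff)
        then show ?thesis using True by simp
      next
        case False
        then show ?thesis
          using \<epsilon> Q F by (intro bound) (auto simp: zero_less_measure_iff)
      qed
      moreover have "sum (emeasure \<mu>) F = ennreal (\<Sum>R\<in>F. measure \<mu> R)"
        using FQ em by (subst sum_ennreal[symmetric]) auto
      ultimately show ?thesis
        by (simp add: em[OF Q] ennreal_mult''[symmetric] ennreal_leI)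
    qed
    \<comment> \<open>In the extended nonnegative reals the infinite sum is the supremum over finite
      subfamilies.\<close>
    then show "(\<Sum>\<^sub>\<infinity>R\<in>all_generations (weight_stopping \<mu> W \<epsilon>) Q. emeasure \<mu> R)
        \<le> ennreal (C / \<epsilon>\<^sup>2) * emeasure \<mu> Q"
      by (subst nonneg_infsum_complete) (auto intro!: SUP_least)
  qed
qed

end
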